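(* Let $g_1,g_2\in L^2(\mathbb{R}^{2d},\mathbb{H})$ be two non-zero quaternion window functions. Then: (1) For all $f_1,f_2\in L^2(\mathbb{R}^{2d},\mathbb{H})$, $$\langle \mathcal{G}_{g_1}(f_1),\mathcal{G}_{g_2}(f_2)\rangle_{2,4d}=\langle f_1\,(\overline{g_1},\overline{g_2})_{2,2d},\,f_2\rangle_{2,2d}.$$ (2) For every $f\in L^2(\mathbb{R}^{2d},\mathbb{H})$, $$\|\mathcal{G}_{g_1}(f)\|_{2,4d}=\|f\|_{2,2d}\,\|g_1\|_{2,2d}.$$ In particular, for every quaternion window function $g$, the map $f\mapsto\mathcal{G}_g(f)$ is a bounded ($\mathbb{R}$-)linear operator from $L^2(\mathbb{R}^{2d},\mathbb{H})$ into $L^2(\mathbb{R}^{2d}\times\mathbb{R}^{2d},\mathbb{H})$; moreover, if $\|g\|_{2,2d}=1$, it is isometric.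
   Context: $d\ge 1$ is an integer and $\mathbb{H}$ is the algebra of quaternions $q=q_0+iq_1+jq_2+kq_3$ with conjugate $\overline q=q_0-iq_1-jq_2-kq_3$, modulus $|q|=\sqrt{q\overline q}$ and scalar part $Sc(q)=q_0$. On $\mathbb{R}^n$, $d\mu_n(x)=dx/(2\pi)^{n/2}$, and $\mathbb{R}^{2d}\times\mathbb{R}^{2d}$ is identified with $\mathbb{R}^{4d}$. For $f,g\in L^2(\mathbb{R}^n,\mathbb{H})$: $(f,g)_{2,n}=\int_{\mathbb{R}^n}f(x)\overline{g(x)}\,d\mu_n(x)\in\mathbb{H}$, $\langle f,g\rangle_{2,n}=Sc\big((f,g)_{2,n}\big)$, $\|f\|_{2,n}=\big(\int_{\mathbb{R}^n}|f|^2d\mu_n\big)^{1/2}$. A quaternion window function is a non-zero $g\in L^2(\mathbb{R}^{2d},\mathbb{H})$. The two sided quaternion windowed Fourier transform (QWFT) of $f\in L^2(\mathbb{R}^{2d},\mathbb{H})$ with respect to $g$ is $$\mathcal{G}_g(f)(x,w)=\int_{\mathbb{R}^{2d}}e^{-i\,s\cdot u}f(y)\overline{g(y-x)}e^{-j\,t\cdot v}\,d\mu_{2d}(y),\quad x\in\mathbb{R}^{2d},\ w=(u,v),\ y=(s,t)\in\mathbb{R}^d\times\mathbb{R}^d.$$ *)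

theory Defs
  imports "HOL-Analysis.Analysis"
begin

section \<open>Quaternions\<close>

datatype quat = Quat (Sc: real) (ImI: real) (ImJ: real) (ImK: real)

lemma quat_eqI:
  "Sc p = Sc q \<Longrightarrow> ImI p = ImI q \<Longrightarrow> ImJ p = ImJ q \<Longrightarrow> ImK p = ImK q \<Longrightarrow> p = q"
  by (cases p; cases q) simp

lemma quat_eq_iff:
  "p = q \<longleftrightarrow> Sc p = Sc q \<and> ImI p = ImI q \<and> ImJ p = ImJ q \<and> ImK p = ImK q"
  by (auto intro: quat_eqI)

instantiation quat :: ab_group_add
begin

definition "0 = Quat 0 0 0 0"
definition "p + q = Quat (Sc p + Sc q) (ImI p + ImI q) (ImJ p + ImJ q) (ImK p + ImK q)"
definition "p - q = Quat (Sc p - Sc q) (ImI p - ImI q) (ImJ p - ImJ q) (ImK p - ImK q)"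
definition "- p = Quat (- Sc p) (- ImI p) (- ImJ p) (- ImK p)"

instance
  by standard (simp_all add: zero_quat_def plus_quat_def minus_quat_def uminus_quat_def quat_eq_iff)

end

instantiation quat :: real_algebra_1
begin

definition "1 = Quat 1 0 0 0"

definition "p * q = Quat
  (Sc p * Sc q - ImI p * ImI q - ImJ p * ImJ q - ImK p * ImK q)
  (Sc p * ImI q + ImI p * Sc q + ImJ p * ImK q - ImK p * ImJ q)
  (Sc p * ImJ q - ImI p * ImK q + ImJ p * Sc q + ImK p * ImI q)
  (Sc p * ImK q + ImI p * ImJ q - ImJ p * ImI q + ImK p * Sc q)"

definition "r *\<^sub>R p = Quat (r * Sc p) (r * ImI p) (r * ImJ p) (r * ImK p)"

instance
  by standard
    (simp_all add: zero_quat_def plus_quat_def one_quat_def times_quat_def scaleR_quat_def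
      quat_eq_iff algebra_simps)

end

lemma quat_sel_simps [simp]:
  "Sc 0 = 0" "ImI 0 = 0" "ImJ 0 = 0" "ImK 0 = 0"
  "Sc 1 = 1" "ImI 1 = 0" "ImJ 1 = 0" "ImK 1 = 0"
  "Sc (p + q) = Sc p + Sc q" "ImI (p + q) = ImI p + ImI q"
  "ImJ (p + q) = ImJ p + ImJ q" "ImK (p + q) = ImK p + ImK q"
  "Sc (p - q) = Sc p - Sc q" "ImI (p - q) = ImI p - ImI q"
  "ImJ (p - q) = ImJ p - ImJ q" "ImK (p - q) = ImK p - ImK q"
  "Sc (- p) = - Sc p" "ImI (- p) = - ImI p" "ImJ (- p) = - ImJ p" "ImK (- p) = - ImK p"
  "Sc (r *\<^sub>R p) = r * Sc p" "ImI (r *\<^sub>R p) = r * ImI p"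
  "ImJ (r *\<^sub>R p) = r * ImJ p" "ImK (r *\<^sub>R p) = r * ImK p"
  by (simp_all add: zero_quat_def one_quat_def plus_quat_def minus_quat_def uminus_quat_def
      scaleR_quat_def)

lemma quat_mult_sel:
  "Sc (p * q) = Sc p * Sc q - ImI p * ImI q - ImJ p * ImJ q - ImK p * ImK q"
  "ImI (p * q) = Sc p * ImI q + ImI p * Sc q + ImJ p * ImK q - ImK p * ImJ q"
  "ImJ (p * q) = Sc p * ImJ q - ImI p * ImK q + ImJ p * Sc q + ImK p * ImI q"
  "ImK (p * q) = Sc p * ImK q + ImI p * ImJ q - ImJ p * ImI q + ImK p * Sc q"
  by (simp_all add: times_quat_def)

definition quat_i :: quat where "quat_i = Quat 0 1 0 0"
definition quat_j :: quat where "quat_j = Quat 0 0 1 0"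
definition quat_k :: quat where "quat_k = Quat 0 0 0 1"

lemma quat_unit_sel [simp]:
  "Sc quat_i = 0" "ImI quat_i = 1" "ImJ quat_i = 0" "ImK quat_i = 0"
  "Sc quat_j = 0" "ImI quat_j = 0" "ImJ quat_j = 1" "ImK quat_j = 0"
  "Sc quat_k = 0" "ImI quat_k = 0" "ImJ quat_k = 0" "ImK quat_k = 1"
  by (simp_all add: quat_i_def quat_j_def quat_k_def)

lemma quat_unit_mult:
  "quat_i * quat_i = - 1" "quat_j * quat_j = - 1" "quat_k * quat_k = - 1"
  "quat_i * quat_j = quat_k" "quat_j * quat_k = quat_i" "quat_k * quat_i = quat_j"
  by (simp_all add: quat_eq_iff quat_mult_sel)

definition qcnj :: "quat \<Rightarrow> quat"
  where "qcnj p = Quat (Sc p) (- ImI p) (- ImJ p) (- ImK p)"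

lemma qcnj_sel [simp]:
  "Sc (qcnj p) = Sc p" "ImI (qcnj p) = - ImI p" "ImJ (qcnj p) = - ImJ p" "ImK (qcnj p) = - ImK p"
  by (simp_all add: qcnj_def)

instantiation quat :: real_inner
begin

definition "inner p q = Sc p * Sc q + ImI p * ImI q + ImJ p * ImJ q + ImK p * ImK q"
definition "norm (p :: quat) = sqrt (inner p p)"
definition "sgn (p :: quat) = p /\<^sub>R norm p"
definition "dist p q = norm (p - q :: quat)"
definition "(uniformity :: (quat \<times> quat) filter) =
  (INF e\<in>{0 <..}. principal {(x, y). dist x y < e})"
definition "open (U :: quat set) \<longleftrightarrow>
  (\<forall>x\<in>U. eventually (\<lambda>(x', y). x' = x \<longrightarrow> y \<in> U) uniformity)"

instance
proof
  fix p q s :: quat and r :: real and U :: "quat set"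
  show "inner p q = inner q p"
    by (simp add: inner_quat_def mult.commute)
  show "inner (p + q) s = inner p s + inner q s"
    by (simp add: inner_quat_def algebra_simps)
  show "inner (r *\<^sub>R p) q = r * inner p q"
    by (simp add: inner_quat_def algebra_simps)
  show "0 \<le> inner p p"
    by (simp add: inner_quat_def)
  show "inner p p = 0 \<longleftrightarrow> p = 0"
    by (simp add: inner_quat_def quat_eq_iff add_nonneg_eq_0_iff)
qed (rule norm_quat_def sgn_quat_def dist_quat_def uniformity_quat_def open_quat_def)+

end

instantiation quat :: real_normed_div_algebra
begin

definition "inverse (p :: quat) = qcnj p /\<^sub>R inner p p"
definition "p div (q :: quat) = p * inverse q"

instance
proof
  fix p q :: quat
  have *: "qcnj p * p = inner p p *\<^sub>R 1" "p * qcnj p = inner p p *\<^sub>R 1"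
    by (simp_all add: quat_eq_iff quat_mult_sel inner_quat_def algebra_simps)
  show "inverse p * p = 1" "p * inverse p = 1" if "p \<noteq> 0"
    using that by (simp_all add: inverse_quat_def *)
  show "p div q = p * inverse q"
    by (rule divide_quat_def)
  show "inverse 0 = (0 :: quat)"
    by (simp add: inverse_quat_def)
  have "inner (p * q) (p * q) = inner p p * inner q q"
    by (simp add: inner_quat_def quat_mult_sel algebra_simps)
  then show "norm (p * q) = norm p * norm q"
    by (simp add: norm_quat_def real_sqrt_mult)
qed

end

instantiation quat :: euclidean_space
begin

definition "Basis = {1, quat_i, quat_j, quat_k}"

instance
proof
  fix u v x :: quat
  show "Basis \<noteq> ({} :: quat set)" "finite (Basis :: quat set)"
    by (simp_all add: Basis_quat_def)
  show "inner u v = (if u = v then 1 else 0)" if "u \<in> Basis" "v \<in> Basis"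
    using that by (auto simp: Basis_quat_def inner_quat_def quat_eq_iff)
  show "(\<forall>u\<in>Basis. inner x u = 0) \<longleftrightarrow> x = 0"
    by (simp add: Basis_quat_def inner_quat_def, simp add: quat_eq_iff)
qed

end

lemma inner_quat_eq_Sc: "inner p q = Sc (p * qcnj q)"
  by (simp add: inner_quat_def quat_mult_sel)

lemma quat_mult_qcnj: "p * qcnj p = of_real ((norm p)\<^sup>2)"
  by (simp add: of_real_def power2_norm_eq_inner quat_eq_iff quat_mult_sel inner_quat_def)

section \<open>Square-integrable quaternion-valued functions\<close>

definition mu :: "'a::euclidean_space measure"
  where "mu = density lebesgue (\<lambda>_. ennreal (1 / (2 * pi) powr (real DIM('a) / 2)))"

text \<open>Elements of \<open>L2\<close> are functions, not equivalence classes; statements about the space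
  of classes are expressed modulo equality almost everywhere.\<close>

definition L2 :: "('a::euclidean_space \<Rightarrow> quat) set"
  where "L2 = {f. f \<in> borel_measurable mu \<and> integrable mu (\<lambda>x. (norm (f x))\<^sup>2)}"

definition qinner_L2 :: "('a::euclidean_space \<Rightarrow> quat) \<Rightarrow> ('a \<Rightarrow> quat) \<Rightarrow> quat"
  where "qinner_L2 f g = (\<integral>x. f x * qcnj (g x) \<partial>mu)"

definition inner_L2 :: "('a::euclidean_space \<Rightarrow> quat) \<Rightarrow> ('a \<Rightarrow> quat) \<Rightarrow> real"
  where "inner_L2 f g = Sc (qinner_L2 f g)"

definition norm_L2 :: "('a::euclidean_space \<Rightarrow> quat) \<Rightarrow> real"
  where "norm_L2 f = sqrt (\<integral>x. (norm (f x))\<^sup>2 \<partial>mu)"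

text \<open>\<open>T\<close> induces a bounded real-linear operator between the spaces of almost-everywhere classes:
  it maps \<open>L2\<close> into \<open>L2\<close>, it respects almost-everywhere equality, and the induced map is additive,
  homogeneous and bounded.\<close>

definition bounded_linear_L2 ::
    "(('a::euclidean_space \<Rightarrow> quat) \<Rightarrow> ('b::euclidean_space \<Rightarrow> quat)) \<Rightarrow> bool"
  where "bounded_linear_L2 T \<longleftrightarrow>
    (\<forall>f\<in>L2. T f \<in> L2) \<and>
    (\<forall>f\<in>L2. \<forall>h\<in>L2. (AE y in mu. f y = h y) \<longrightarrow> (AE z in mu. T f z = T h z)) \<and>
    (\<forall>f\<in>L2. \<forall>h\<in>L2. AE z in mu. T (\<lambda>y. f y + h y) z = T f z + T h z) \<and>
    (\<forall>r::real. \<forall>f\<in>L2. AE z in mu. T (\<lambda>y. r *\<^sub>R f y) z = r *\<^sub>R T f z) \<and>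
    (\<exists>K. \<forall>f\<in>L2. norm_L2 (T f) \<le> norm_L2 f * K)"

definition isometric_L2 ::
    "(('a::euclidean_space \<Rightarrow> quat) \<Rightarrow> ('b::euclidean_space \<Rightarrow> quat)) \<Rightarrow> bool"
  where "isometric_L2 T \<longleftrightarrow> (\<forall>f\<in>L2. norm_L2 (T f) = norm_L2 f)"

section \<open>The two-sided quaternion windowed Fourier transform\<close>

text \<open>Nonzero as an element of the space of classes.\<close>

definition quat_window :: "('a::euclidean_space \<Rightarrow> quat) \<Rightarrow> bool"
  where "quat_window g \<longleftrightarrow> g \<in> L2 \<and> \<not> (AE x in mu. g x = 0)"

text \<open>With \<open>d = CARD('d)\<close>, a point of \<open>2d\<close>-dimensional space is a pair \<open>(s, t)\<close> of vectors.\<close>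

definition qwft ::
    "((real^'d) \<times> (real^'d) \<Rightarrow> quat) \<Rightarrow> ((real^'d) \<times> (real^'d) \<Rightarrow> quat)
      \<Rightarrow> ((real^'d) \<times> (real^'d)) \<times> ((real^'d) \<times> (real^'d)) \<Rightarrow> quat"
  where "qwft g f = (\<lambda>(x, (u, v)). \<integral>(s, t).
    exp (- ((s \<bullet> u) *\<^sub>R quat_i)) * f (s, t) * qcnj (g ((s, t) - x)) *
    exp (- ((t \<bullet> v) *\<^sub>R quat_j)) \<partial>mu)"

end

theory Submission
  imports Defs "HOL-Probability.Characteristic_Functions"
begin

text \<open>
  For fixed \<open>x\<close> the function \<open>w \<mapsto> qwft g f (x, w)\<close> is the two-sided quaternion Fourier transform of
  \<open>y \<mapsto> f y * qcnj (g (y - x))\<close>, which is integrable for every \<open>x\<close> and square integrable for almost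
  every \<open>x\<close>. So everything follows from Parseval's identity for that transform, integrated over \<open>x\<close>,
  and Fubini's theorem.

  Plancherel's identity is obtained by damping with a Gaussian of width \<open>1 / e\<close>:
  since the Gaussian is even, the terms of \<open>inner (kern w y p) (kern w y' q)\<close> that contain a sine
  integrate to zero, and the damped energy of the transform of \<open>h\<close> is the average of the
  autocorrelation of \<open>h\<close> against a Gaussian of width \<open>e\<close>. Fatou's lemma then gives the inequality
  \<open>\<le>\<close>, dominated convergence gives equality when \<open>h\<close> is bounded and continuous, and the general case
  follows by density, the inequality providing the continuity.
\<close>

section \<open>Change of variables and products\<close>

text \<open>The exponentials stand on both sides of the values and do not commute with them. In the
  quaternion-valued product of one transform with the conjugate of another only the right-hand
  exponentials meet; the left-hand ones merge only under the scalar part, which is cyclic. This is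
  why the identities are about the real inner product \<open>inner\<close>, for which polarization
  of a norm identity is enough.

  Damping is needed because the norm of the kernel does not depend on \<open>w\<close>: over the
  whole frequency space the order of integration cannot be exchanged, and square integrability of
  the transform is not known beforehand.

  Fubini's theorem is used for \<open>lborel\<close>, where the product of two copies is again
  \<open>lborel\<close>; for the completed measure behind \<open>mu\<close> this is false. Hence the
  analysis concerns Borel functions, and Borel representatives are inserted at the end.

  Constants: the density of \<open>mu\<close> in dimension \<open>4d\<close> cancels the Plancherel
  constant of dimension \<open>2d\<close>, and the densities inside the two transforms become those
  of the two inner products on the right-hand side.\<close>

lemma nn_integral_lborel_affine:
  fixes f :: "'a::euclidean_space \<Rightarrow> ennreal"
  assumes [measurable]: "f \<in> borel_measurable borel" and c: "c \<noteq> 0"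
  shows "(\<integral>\<^sup>+x. f x \<partial>lborel) = \<bar>c\<bar> ^ DIM('a) * (\<integral>\<^sup>+x. f (t + c *\<^sub>R x) \<partial>lborel)"
  by (subst lborel_affine[OF c, of t])
     (simp add: nn_integral_density nn_integral_distr nn_integral_cmult ennreal_power)

lemma integrable_lborel_affine:
  fixes f :: "'a::euclidean_space \<Rightarrow> 'b::{banach, second_countable_topology}"
  assumes f: "integrable lborel f" and c: "c \<noteq> 0"
  shows "integrable lborel (\<lambda>x. f (t + c *\<^sub>R x))"
proof -
  have [measurable]: "f \<in> borel_measurable borel"
    using borel_measurable_integrable[OF f] by simp
  have "(\<integral>\<^sup>+x. norm (f x) \<partial>lborel) < \<infinity>"
    using f by (simp add: integrable_iff_bounded)
  then have "(\<integral>\<^sup>+x. norm (f (t + c *\<^sub>R x)) \<partial>lborel) < \<infinity>"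
    using c by (subst (asm) nn_integral_lborel_affine[where c=c and t=t])
      (auto simp: ennreal_mult_less_top)
  then show ?thesis
    by (simp add: integrable_iff_bounded)
qed

lemma integral_lborel_affine:
  fixes f :: "'a::euclidean_space \<Rightarrow> 'b::{banach, second_countable_topology}"
  assumes [measurable]: "f \<in> borel_measurable borel" and c: "c \<noteq> 0"
  shows "(\<integral>x. f x \<partial>lborel) = \<bar>c\<bar> ^ DIM('a) *\<^sub>R (\<integral>x. f (t + c *\<^sub>R x) \<partial>lborel)"
  by (subst lborel_affine[OF c, of t])
     (simp add: integral_density integral_distr)

lemma integrable_lborel_shift:
  fixes f :: "'a::euclidean_space \<Rightarrow> 'b::{banach, second_countable_topology}"
  shows "integrable lborel f \<Longrightarrow> integrable lborel (\<lambda>x. f (x + t))"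
  using integrable_lborel_affine[of f 1 t] by (simp add: add.commute)

lemma integral_lborel_shift:
  fixes f :: "'a::euclidean_space \<Rightarrow> 'b::{banach, second_countable_topology}"
  assumes "f \<in> borel_measurable borel"
  shows "(\<integral>x. f (x + t) \<partial>lborel) = (\<integral>x. f x \<partial>lborel)"
  using integral_lborel_affine[OF assms, of 1 t] by (simp add: add.commute)

lemma integrable_lborel_reflect:
  fixes f :: "'a::euclidean_space \<Rightarrow> 'b::{banach, second_countable_topology}"
  shows "integrable lborel f \<Longrightarrow> integrable lborel (\<lambda>x. f (t - x))"
  using integrable_lborel_affine[of f "-1" t] by simp

lemma integral_lborel_reflect:
  fixes f :: "'a::euclidean_space \<Rightarrow> 'b::{banach, second_countable_topology}"
  assumes "f \<in> borel_measurable borel"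
  shows "(\<integral>x. f (t - x) \<partial>lborel) = (\<integral>x. f x \<partial>lborel)"
  using integral_lborel_affine[OF assms, of "-1" t] by simp

section \<open>The Fourier transform of a Gaussian\<close>

text \<open>Rescaled by \<open>e\<close>, this is the characteristic function of the standard normal
  distribution; the factor \<open>sqrt (2 * pi)\<close> undoes the normalization of its
  density.\<close>

lemma integral_cexp_gaussian_real:
  fixes a e :: real
  assumes "e > 0"
  shows "integrable lborel (\<lambda>x. exp (\<i> * of_real (a * x)) * complex_of_real (exp (- (e * x)\<^sup>2 / 2)))" (is "integrable _ ?f")
    and "(\<integral>x. exp (\<i> * of_real (a * x)) * complex_of_real (exp (- (e * x)\<^sup>2 / 2)) \<partial>lborel)
      = of_real (sqrt (2 * pi) / e * exp (- (a / e)\<^sup>2 / 2))"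
proof -
  let ?h = "\<lambda>t x. exp (\<i> * of_real (t * x)) * complex_of_real (exp (- x\<^sup>2 / 2))"
  have d: "exp (- x\<^sup>2 / 2) = sqrt (2 * pi) * std_normal_density x" for x :: real
    by (simp add: std_normal_density_def)
  have int: "integrable lborel (?h t)" for t
  proof (rule Bochner_Integration.integrable_bound)
    show "integrable lborel (\<lambda>x. sqrt (2 * pi) * std_normal_density x)"
      by simp
    show "AE x in lborel. norm (?h t x) \<le> norm (sqrt (2 * pi) * std_normal_density x)"
      unfolding d by (simp add: norm_mult abs_mult)
  qed simp
  have val: "(\<integral>x. ?h t x \<partial>lborel) = of_real (sqrt (2 * pi) * exp (- t\<^sup>2 / 2))" for t
  proof -
    have "complex_of_real (exp (- t\<^sup>2 / 2)) = char std_normal_distribution t"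
      by (simp add: char_std_normal_distribution)
    also have "\<dots> = (\<integral>x. std_normal_density x *\<^sub>R exp (\<i> * of_real (t * x)) \<partial>lborel)"
      unfolding char_def by (subst integral_density) auto
    finally have ch: "(\<integral>x. std_normal_density x *\<^sub>R exp (\<i> * of_real (t * x)) \<partial>lborel) =
      complex_of_real (exp (- t\<^sup>2 / 2))" ..
    have "(\<integral>x. ?h t x \<partial>lborel) =
        (\<integral>x. complex_of_real (sqrt (2 * pi)) * (std_normal_density x *\<^sub>R exp (\<i> * of_real (t * x))) \<partial>lborel)"
      unfolding d by (simp add: scaleR_conv_of_real mult_ac)
    also have "\<dots> = complex_of_real (sqrt (2 * pi)) * of_real (exp (- t\<^sup>2 / 2))"
      unfolding integral_mult_right_zero ch ..
    finally show ?thesis by simp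
  qed
  have eq: "?f = (\<lambda>x. ?h (a / e) (0 + e *\<^sub>R x))"
    using assms by (auto simp: fun_eq_iff)
  show "integrable lborel ?f"
    unfolding eq by (rule integrable_lborel_affine[OF int[of "a / e"]]) (use assms in simp)
  show "(\<integral>x. ?f x \<partial>lborel) = of_real (sqrt (2 * pi) / e * exp (- (a / e)\<^sup>2 / 2))"
    using integral_lborel_affine[of "?h (a / e)" e 0] assms unfolding eq val
    by (simp add: scaleR_conv_of_real field_simps del: of_real_add)
qed

text \<open>Both factors of the integrand split into products over the coordinates, and
  \<open>lborel\<close> is the image of a product of one-dimensional measures, so the integral is a
  product of integrals over the real line.\<close>

lemma integral_cexp_gaussian:
  fixes a :: "'a::euclidean_space"
  assumes "e > 0"
  shows "integrable lborel (\<lambda>x. exp (\<i> * of_real (a \<bullet> x)) * complex_of_real (exp (- (e * norm x)\<^sup>2 / 2)))"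
    (is "integrable _ ?f")
    and "(\<integral>x. exp (\<i> * of_real (a \<bullet> x)) * complex_of_real (exp (- (e * norm x)\<^sup>2 / 2)) \<partial>lborel)
      = of_real ((sqrt (2 * pi) / e) ^ DIM('a) * exp (- (norm a / e)\<^sup>2 / 2))"
proof -
  interpret P: product_sigma_finite "\<lambda>_::'a. lborel :: real measure" ..
  let ?g = "\<lambda>b x. exp (\<i> * of_real (a \<bullet> b * x)) * complex_of_real (exp (- (e * x)\<^sup>2 / 2))"
  have sq: "(\<Sum>b\<in>Basis. (k * (x \<bullet> b))\<^sup>2) = (k * norm x)\<^sup>2" for k :: real and x :: 'a
    unfolding power_mult_distrib power2_norm_eq_inner euclidean_inner[of x x]
    by (simp add: sum_distrib_left power2_eq_square)
  have f: "?f x = (\<Prod>b\<in>Basis. ?g b (x \<bullet> b))" for x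
  proof -
    have "(\<Prod>b\<in>Basis. exp (\<i> * of_real (a \<bullet> b * (x \<bullet> b)))) = exp (\<i> * of_real (a \<bullet> x))"
      unfolding euclidean_inner[of a x] by (simp add: sum_distrib_left flip: exp_sum)
    moreover have "(\<Prod>b\<in>Basis. exp (- (e * (x \<bullet> b))\<^sup>2 / 2)) = exp (- (e * norm x)\<^sup>2 / 2)"
      by (simp flip: exp_sum sum_divide_distrib add: sum_negf sq)
    ultimately show ?thesis
      by (simp add: prod.distrib flip: of_real_prod)
  qed
  have g: "integrable lborel (?g b)"
    "integral\<^sup>L lborel (?g b) = of_real (sqrt (2 * pi) / e * exp (- (a \<bullet> b / e)\<^sup>2 / 2))" for b
    using integral_cexp_gaussian_real[OF assms, of "a \<bullet> b"] by auto
  have coord: "(\<Sum>b\<in>Basis. y b *\<^sub>R b) \<bullet> b = y b" if "b \<in> Basis" for y and b :: 'a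
    using that by (simp add: inner_sum_left inner_Basis if_distrib cong: if_cong)
  have F: "?f (\<Sum>b\<in>Basis. y b *\<^sub>R b) = (\<Prod>b\<in>Basis. ?g b (y b))" for y
    unfolding f by (rule prod.cong) (simp_all add: coord)
  have "integrable (\<Pi>\<^sub>M b\<in>Basis. lborel) (\<lambda>y. \<Prod>b\<in>(Basis::'a set). ?g b (y b))"
    by (rule P.product_integrable_prod) (simp, rule g)
  then show "integrable lborel ?f"
    by (subst lborel_eq, subst integrable_distr_eq) (measurable, simp only: F)
  have "(\<integral>x. ?f x \<partial>lborel) = (\<integral>y. (\<Prod>b\<in>(Basis::'a set). ?g b (y b)) \<partial>(\<Pi>\<^sub>M b\<in>Basis. lborel))"
    by (subst lborel_eq, subst integral_distr) (measurable, simp only: F)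
  also have "\<dots> = (\<Prod>b\<in>(Basis::'a set). integral\<^sup>L lborel (?g b))"
    by (rule P.product_integral_prod) (simp, rule g)
  also have "\<dots> = of_real (\<Prod>b\<in>(Basis::'a set). sqrt (2 * pi) / e * exp (- (a \<bullet> b / e)\<^sup>2 / 2))"
    unfolding g by simp
  also have "(\<Prod>b\<in>(Basis::'a set). sqrt (2 * pi) / e * exp (- (a \<bullet> b / e)\<^sup>2 / 2)) =
      (sqrt (2 * pi) / e) ^ DIM('a) * exp (- (norm a / e)\<^sup>2 / 2)"
    unfolding prod.distrib prod_constant
    using sq[of "1 / e" a] by (simp flip: exp_sum sum_divide_distrib add: sum_negf)
  finally show "(\<integral>x. ?f x \<partial>lborel) = of_real \<dots>" .
qed

section \<open>Quaternions and the two-sided Fourier kernel\<close>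

text \<open>\<open>lborel\<close> on a product type carries the Borel sets of that type; continuity
  of the projections makes them measurable for these directly.\<close>

lemma borel_measurable_fst_borel [measurable (raw)]:
  fixes f :: "'c \<Rightarrow> 'a::second_countable_topology \<times> 'b::second_countable_topology"
  assumes "f \<in> borel_measurable M"
  shows "(\<lambda>x. fst (f x)) \<in> borel_measurable M"
  using assms by (rule borel_measurable_continuous_on[rotated]) (intro continuous_intros)

lemma borel_measurable_snd_borel [measurable (raw)]:
  fixes f :: "'c \<Rightarrow> 'a::second_countable_topology \<times> 'b::second_countable_topology"
  assumes "f \<in> borel_measurable M"
  shows "(\<lambda>x. snd (f x)) \<in> borel_measurable M"
  using assms by (rule borel_measurable_continuous_on[rotated]) (intro continuous_intros)

lemma (in pair_sigma_finite) integrable_product_mult: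
  fixes f :: "'a \<Rightarrow> real" and g :: "'b \<Rightarrow> real"
  assumes "integrable M1 f" "integrable M2 g"
  shows "integrable (M1 \<Otimes>\<^sub>M M2) (\<lambda>z. f (fst z) * g (snd z))"
  using assms by (intro Fubini_integrable) (simp_all add: abs_mult)

lemma (in pair_sigma_finite) integral_product_mult:
  fixes f :: "'a \<Rightarrow> real" and g :: "'b \<Rightarrow> real"
  assumes "integrable M1 f" "integrable M2 g"
  shows "(\<integral>z. f (fst z) * g (snd z) \<partial>(M1 \<Otimes>\<^sub>M M2)) = integral\<^sup>L M1 f * integral\<^sup>L M2 g"
  by (subst integral_fst'[OF integrable_product_mult[OF assms], symmetric]) simp

lemma bounded_linear_qcnj: "bounded_linear qcnj"
  by (intro linear_conv_bounded_linear[THEN iffD1] linearI) (simp_all add: quat_eq_iff)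

lemma bounded_linear_Sc: "bounded_linear Sc"
  by (intro linear_conv_bounded_linear[THEN iffD1] linearI) simp_all

lemma qcnj_qcnj [simp]: "qcnj (qcnj p) = p"
  by (simp add: quat_eq_iff)

lemma norm_qcnj [simp]: "norm (qcnj p) = norm p"
  by (simp add: norm_quat_def inner_quat_def)

lemma borel_measurable_qcnj [measurable (raw)]:
  "f \<in> borel_measurable M \<Longrightarrow> (\<lambda>x. qcnj (f x)) \<in> borel_measurable M"
  by (rule borel_measurable_continuous_on[OF linear_continuous_on[OF bounded_linear_qcnj]])

text \<open>\<open>inner p q\<close> is the scalar part of \<open>p * qcnj q\<close>, and the scalar
  part is cyclic. The quaternion-valued product itself obeys only the second rule, so the first is
  where passing to scalar parts is essential.\<close>

lemma inner_mult_adjoint: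
  fixes p q r :: quat
  shows "inner (r * p) q = inner p (qcnj r * q)" "inner (p * r) q = inner p (q * qcnj r)"
  by (simp_all add: inner_quat_def quat_mult_sel algebra_simps)

lemma exp_scaleR_unit:
  fixes u :: "'a::{banach, real_normed_algebra_1}"
  assumes u: "u * u = - 1"
  shows "exp (r *\<^sub>R u) = cos r *\<^sub>R 1 + sin r *\<^sub>R u"
proof -
  \<comment> \<open>\<open>\<phi>\<close> is a continuous algebra homomorphism from the complex numbers, so it commutes with \<open>exp\<close>.\<close>
  define \<phi> where "\<phi> z = Re z *\<^sub>R 1 + Im z *\<^sub>R u" for z
  have lin: "bounded_linear \<phi>"
    unfolding \<phi>_def
    by (intro bounded_linear_add bounded_linear_compose[OF bounded_linear_scaleR_left]
        bounded_linear_Re bounded_linear_Im)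
  have mult: "\<phi> (z * w) = \<phi> z * \<phi> w" for z w
    by (simp add: \<phi>_def algebra_simps u)
  have pow: "\<phi> (z ^ n) = \<phi> z ^ n" for z n
    by (induction n) (simp_all add: mult, simp add: \<phi>_def)
  have "(\<lambda>n. \<phi> ((\<i> * r) ^ n /\<^sub>R fact n)) sums \<phi> (exp (\<i> * r))"
    by (intro bounded_linear.sums[OF lin] exp_converges)
  moreover have "(\<lambda>n. \<phi> ((\<i> * r) ^ n /\<^sub>R fact n)) sums exp (\<phi> (\<i> * r))"
    using exp_converges[of "\<phi> (\<i> * r)"]
    by (simp only: linear_scale[OF bounded_linear.linear[OF lin]] pow)
  ultimately have "exp (\<phi> (\<i> * r)) = \<phi> (exp (\<i> * r))"
    by (rule sums_unique2[symmetric])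
  then show ?thesis
    by (simp add: \<phi>_def Re_exp Im_exp)
qed

lemma exp_quat_i: "exp (- (r *\<^sub>R quat_i)) = cos r *\<^sub>R 1 - sin r *\<^sub>R quat_i"
  using exp_scaleR_unit[OF quat_unit_mult(1), of "- r"] by simp

lemma exp_quat_j: "exp (- (r *\<^sub>R quat_j)) = cos r *\<^sub>R 1 - sin r *\<^sub>R quat_j"
  using exp_scaleR_unit[OF quat_unit_mult(2), of "- r"] by simp

text \<open>The value \<open>q\<close> is an argument because it sits between two exponentials with
  which it does not commute, so no scalar kernel can be split off.\<close>

definition kern :: "'a::euclidean_space \<times> 'a \<Rightarrow> 'a \<times> 'a \<Rightarrow> quat \<Rightarrow> quat" where
  "kern w y q = exp (- ((fst y \<bullet> fst w) *\<^sub>R quat_i)) * q * exp (- ((snd y \<bullet> snd w) *\<^sub>R quat_j))"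

lemma kern_alt: "kern w y q =
    (cos (fst y \<bullet> fst w) *\<^sub>R 1 - sin (fst y \<bullet> fst w) *\<^sub>R quat_i) * q *
    (cos (snd y \<bullet> snd w) *\<^sub>R 1 - sin (snd y \<bullet> snd w) *\<^sub>R quat_j)"
  by (simp add: kern_def exp_quat_i exp_quat_j)

lemma norm_kern [simp]: "norm (kern w y q) = norm q"
proof -
  have "norm (cos r *\<^sub>R 1 - sin r *\<^sub>R quat_i) = 1" "norm (cos r *\<^sub>R 1 - sin r *\<^sub>R quat_j) = 1" for r
    by (simp_all add: norm_quat_def inner_quat_def flip: power2_eq_square)
  then show ?thesis
    by (simp add: kern_alt norm_mult)
qed

lemma kern_add: "kern w y (p + q) = kern w y p + kern w y q"
  and kern_diff: "kern w y (p - q) = kern w y p - kern w y q"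
  by (simp_all add: kern_def algebra_simps)

lemma borel_measurable_kern [measurable (raw)]:
  assumes [measurable]: "f \<in> borel_measurable M" "g \<in> borel_measurable M" "h \<in> borel_measurable M"
  shows "(\<lambda>x. kern (f x) (g x) (h x)) \<in> borel_measurable M"
  unfolding kern_alt by measurable

text \<open>Taking adjoints brings the two left exponentials together in the commutative plane of
  \<open>1\<close> and \<open>quat_i\<close>, and the two right ones in that of \<open>1\<close> and
  \<open>quat_j\<close>; hence only \<open>y - y'\<close> matters. The expansion then separates the
  frequency \<open>w\<close> from the values \<open>p\<close> and \<open>q\<close>.\<close>

lemma inner_kern_kern:
  "inner (kern w y p) (kern w y' q) =
    cos (fst (y - y') \<bullet> fst w) * cos (snd (y - y') \<bullet> snd w) * inner p q
  + cos (fst (y - y') \<bullet> fst w) * sin (snd (y - y') \<bullet> snd w) * inner p (q * quat_j)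
  - sin (fst (y - y') \<bullet> fst w) * cos (snd (y - y') \<bullet> snd w) * inner (quat_i * p) q
  - sin (fst (y - y') \<bullet> fst w) * sin (snd (y - y') \<bullet> snd w) * inner (quat_i * p) (q * quat_j)"
proof -
  let ?e = "\<lambda>r. cos r *\<^sub>R 1 - sin r *\<^sub>R quat_i" and ?f = "\<lambda>r. cos r *\<^sub>R 1 - sin r *\<^sub>R quat_j"
  have e: "qcnj (?e a') * ?e a = ?e (a - a')" for a a'
    by (simp add: quat_eq_iff quat_mult_sel cos_diff sin_diff)
  have f: "?f b' * qcnj (?f b) = cos (b - b') *\<^sub>R 1 + sin (b - b') *\<^sub>R quat_j" for b b'
    by (simp add: quat_eq_iff quat_mult_sel cos_diff sin_diff)
  have main: "inner (?e a * p * ?f b) (?e a' * q * ?f b') =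
      inner (?e (a - a') * p) (q * (cos (b - b') *\<^sub>R 1 + sin (b - b') *\<^sub>R quat_j))" for a a' b b'
    \<comment> \<open>The left rule is read from right to left: \<open>?e a'\<close> leaves the
      second argument as its conjugate, hence the instance with \<open>qcnj (?e a')\<close>.\<close>
    using inner_mult_adjoint(2)[of "?e a * p" "?f b" "?e a' * q * ?f b'"]
      inner_mult_adjoint(1)[of "qcnj (?e a')" "?e a * p" "q * (?f b' * qcnj (?f b))"]
    unfolding e[symmetric] f[symmetric] by (simp only: qcnj_qcnj mult.assoc)
  have "inner ((c *\<^sub>R 1 - s *\<^sub>R quat_i) * p) (q * (c' *\<^sub>R 1 + s' *\<^sub>R quat_j)) =
      c * c' * inner p q + c * s' * inner p (q * quat_j)
      - s * c' * inner (quat_i * p) q - s * s' * inner (quat_i * p) (q * quat_j)" for c s c' s'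
    by (simp add: left_diff_distrib distrib_left inner_diff_left inner_add_right algebra_simps)
  then show ?thesis
    unfolding kern_alt main by (simp only: inner_diff_left fst_diff snd_diff)
qed

section \<open>Gaussian damping of the quaternion Fourier transform\<close>

text \<open>The parameter is an inverse width: \<open>gaussian e\<close> tends to 1 as
  \<open>e\<close> tends to 0, and its Fourier transform is a multiple of
  \<open>gaussian (1 / e)\<close>.\<close>

definition gaussian :: "real \<Rightarrow> 'a::euclidean_space \<Rightarrow> real" where
  "gaussian e x = exp (- (e * norm x)\<^sup>2 / 2)"

lemma gaussian_nonneg [simp]: "0 \<le> gaussian e x"
  by (simp add: gaussian_def)

lemma gaussian_le_1: "gaussian e x \<le> 1"
  by (simp add: gaussian_def)

lemma borel_measurable_gaussian [measurable]: "gaussian e \<in> borel_measurable borel"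
  unfolding gaussian_def by measurable

lemma gaussian_Pair: "gaussian e w = gaussian e (fst w) * gaussian e (snd w)"
  unfolding gaussian_def exp_add[symmetric]
  by (cases w) (simp add: norm_Pair power_mult_distrib field_simps)

lemma integrable_gaussian:
  fixes a :: "'a::euclidean_space"
  assumes "e > 0"
  shows "integrable lborel (\<lambda>x. cos (a \<bullet> x) * gaussian e x)"
    and "integrable lborel (\<lambda>x. sin (a \<bullet> x) * gaussian e x)"
    and "integrable lborel (gaussian e :: 'a \<Rightarrow> real)"
proof -
  show *: "integrable lborel (\<lambda>x. cos (a \<bullet> x) * gaussian e x)" for a :: 'a
    using integrable_Re[OF integral_cexp_gaussian(1)[OF assms, of a]]
    by (simp add: gaussian_def Re_exp)
  show "integrable lborel (gaussian e :: 'a \<Rightarrow> real)"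
    using *[of 0] by simp
  show "integrable lborel (\<lambda>x. sin (a \<bullet> x) * gaussian e x)"
    using integrable_Im[OF integral_cexp_gaussian(1)[OF assms, of a]]
    by (simp add: gaussian_def Im_exp)
qed

lemma integral_gaussian:
  fixes a :: "'a::euclidean_space"
  assumes "e > 0"
  shows "(\<integral>x. cos (a \<bullet> x) * gaussian e x \<partial>lborel) = (sqrt (2 * pi) / e) ^ DIM('a) * gaussian (1 / e) a"
    and "(\<integral>x. sin (a \<bullet> x) * gaussian e x \<partial>lborel) = 0"
    and "(\<integral>x. gaussian e (x::'a) \<partial>lborel) = (sqrt (2 * pi) / e) ^ DIM('a)"
proof -
  show *: "(\<integral>x. cos (a \<bullet> x) * gaussian e x \<partial>lborel) = (sqrt (2 * pi) / e) ^ DIM('a) * gaussian (1 / e) a" for a :: 'a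
    using integral_Re[OF integral_cexp_gaussian(1)[OF assms, of a]]
    unfolding integral_cexp_gaussian(2)[OF assms] by (simp add: gaussian_def Re_exp)
  show "(\<integral>x. sin (a \<bullet> x) * gaussian e x \<partial>lborel) = 0"
    using integral_Im[OF integral_cexp_gaussian(1)[OF assms, of a]]
    unfolding integral_cexp_gaussian(2)[OF assms] by (simp add: gaussian_def Im_exp)
  show "(\<integral>x. gaussian e (x::'a) \<partial>lborel) = (sqrt (2 * pi) / e) ^ DIM('a)"
    using *[of 0] by (simp add: gaussian_def)
qed

text \<open>The Gaussian factorizes over the two halves of \<open>w\<close>, so each term of
  \<open>inner_kern_kern\<close> becomes a product of two integrals, of which only the product of
  cosines survives. The outcome is an approximate identity in \<open>y - y'\<close>.\<close>

lemma integral_gaussian_inner_kern: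
  fixes y y' :: "'a::euclidean_space \<times> 'a"
  assumes e: "e > 0"
  shows "(\<integral>w. gaussian e w * inner (kern w y p) (kern w y' q) \<partial>lborel) =
    (sqrt (2 * pi) / e) ^ DIM('a \<times> 'a) * (gaussian (1 / e) (y - y') * inner p q)"
proof -
  let ?C = "\<lambda>a x::'a. cos (a \<bullet> x) * gaussian e x"
  let ?S = "\<lambda>a x::'a. sin (a \<bullet> x) * gaussian e x"
  \<comment> \<open>\<open>has_bochner_integral\<close> carries integrability along with the value,
    so the four terms can be added without separate integrability proofs.\<close>
  have prod: "has_bochner_integral lborel (\<lambda>w. f (fst w) * g (snd w)) (integral\<^sup>L lborel f * integral\<^sup>L lborel g)"
    if "integrable lborel f" "integrable lborel g" for f g :: "'a \<Rightarrow> real"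
    using lborel_pair.integrable_product_mult[OF that] lborel_pair.integral_product_mult[OF that]
    by (simp add: has_bochner_integral_iff lborel_prod)
  define a where "a = fst (y - y')"
  define b where "b = snd (y - y')"
  have "gaussian e w * inner (kern w y p) (kern w y' q) =
      ?C a (fst w) * ?C b (snd w) * inner p q
    + ?C a (fst w) * ?S b (snd w) * inner p (q * quat_j)
    - ?S a (fst w) * ?C b (snd w) * inner (quat_i * p) q
    - ?S a (fst w) * ?S b (snd w) * inner (quat_i * p) (q * quat_j)" for w
    unfolding gaussian_Pair[of e w] inner_kern_kern a_def b_def by (simp add: algebra_simps)
  moreover have "has_bochner_integral lborel (\<lambda>w.
      ?C a (fst w) * ?C b (snd w) * inner p q
    + ?C a (fst w) * ?S b (snd w) * inner p (q * quat_j)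
    - ?S a (fst w) * ?C b (snd w) * inner (quat_i * p) q
    - ?S a (fst w) * ?S b (snd w) * inner (quat_i * p) (q * quat_j))
    (integral\<^sup>L lborel (?C a) * integral\<^sup>L lborel (?C b) * inner p q
    + integral\<^sup>L lborel (?C a) * integral\<^sup>L lborel (?S b) * inner p (q * quat_j)
    - integral\<^sup>L lborel (?S a) * integral\<^sup>L lborel (?C b) * inner (quat_i * p) q
    - integral\<^sup>L lborel (?S a) * integral\<^sup>L lborel (?S b) * inner (quat_i * p) (q * quat_j))"
    by (intro has_bochner_integral_diff has_bochner_integral_add has_bochner_integral_mult_left prod
        integrable_gaussian e)
  ultimately have "(\<integral>w. gaussian e w * inner (kern w y p) (kern w y' q) \<partial>lborel) =
    integral\<^sup>L lborel (?C a) * integral\<^sup>L lborel (?C b) * inner p q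
    + integral\<^sup>L lborel (?C a) * integral\<^sup>L lborel (?S b) * inner p (q * quat_j)
    - integral\<^sup>L lborel (?S a) * integral\<^sup>L lborel (?C b) * inner (quat_i * p) q
    - integral\<^sup>L lborel (?S a) * integral\<^sup>L lborel (?S b) * inner (quat_i * p) (q * quat_j)"
    by (simp add: has_bochner_integral_iff)
  also have "\<dots> = (sqrt (2 * pi) / e) ^ DIM('a \<times> 'a) * (gaussian (1 / e) (y - y') * inner p q)"
    unfolding integral_gaussian[OF e] gaussian_Pair[of _ "y - y'"] a_def b_def
    by (simp add: power_add algebra_simps)
  finally show ?thesis .
qed

text \<open>The integral is over Lebesgue measure, so the factor \<open>(2 * pi) ^ DIM('a \<times> 'a)\<close> appears in
  Plancherel's identity.\<close>

definition qft :: "('a::euclidean_space \<times> 'a \<Rightarrow> quat) \<Rightarrow> 'a \<times> 'a \<Rightarrow> quat" where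
  "qft h w = (\<integral>y. kern w y (h y) \<partial>lborel)"

lemma integrable_kern:
  assumes "integrable lborel h"
  shows "integrable lborel (\<lambda>y. kern w y (h y))"
  using assms by (rule Bochner_Integration.integrable_bound) (use assms in simp_all)

lemma borel_measurable_qft [measurable]:
  assumes [measurable]: "h \<in> borel_measurable borel"
  shows "qft h \<in> borel_measurable borel"
proof -
  have "(\<lambda>w. \<integral>y. kern w y (h y) \<partial>lborel) \<in> borel_measurable (lborel :: ('a \<times> 'a) measure)"
    by (rule lborel.borel_measurable_lebesgue_integral) (simp add: case_prod_beta)
  then show ?thesis
    by (simp add: qft_def[abs_def])
qed

lemma integrable_inner_product:
  fixes f :: "'a::euclidean_space \<Rightarrow> 'c::euclidean_space" and g :: "'b::euclidean_space \<Rightarrow> 'c"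
  assumes f: "integrable lborel f" and g: "integrable lborel g"
  shows "integrable (lborel \<Otimes>\<^sub>M lborel) (\<lambda>z. inner (f (fst z)) (g (snd z)))"
proof (rule Bochner_Integration.integrable_bound)
  show "integrable (lborel \<Otimes>\<^sub>M lborel) (\<lambda>z::'a \<times> 'b. norm (f (fst z)) * norm (g (snd z)))"
    using f g by (intro lborel_pair.integrable_product_mult integrable_norm)
  have [measurable]: "f \<in> borel_measurable borel" "g \<in> borel_measurable borel"
    using f g by (auto dest: borel_measurable_integrable)
  show "(\<lambda>z. inner (f (fst z)) (g (snd z))) \<in> borel_measurable (lborel \<Otimes>\<^sub>M lborel)"
    by measurable
qed (simp add: Cauchy_Schwarz_ineq2)

lemma integral_inner_product:
  fixes f :: "'a::euclidean_space \<Rightarrow> 'c::euclidean_space" and g :: "'b::euclidean_space \<Rightarrow> 'c"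
  assumes f: "integrable lborel f" and g: "integrable lborel g"
  shows "(\<integral>z. inner (f (fst z)) (g (snd z)) \<partial>(lborel \<Otimes>\<^sub>M lborel)) = inner (integral\<^sup>L lborel f) (integral\<^sup>L lborel g)"
  using f g by (subst lborel_pair.integral_fst'[OF integrable_inner_product[OF f g], symmetric]) simp

text \<open>The squared norm of the transform is a double integral over pairs of points. Since
  \<open>kern\<close> preserves norms, the Gaussian times \<open>norm (h y) * norm (h y')\<close> is
  an integrable majorant, and the frequency integral may be carried out first.\<close>

lemma integral_gaussian_qft:
  fixes h :: "'a::euclidean_space \<times> 'a \<Rightarrow> quat"
  assumes e: "e > 0" and h: "integrable lborel h"
  shows "integrable lborel (\<lambda>w. gaussian e w * (norm (qft h w))\<^sup>2)"
    and "(\<integral>w. gaussian e w * (norm (qft h w))\<^sup>2 \<partial>lborel) = (sqrt (2 * pi) / e) ^ DIM('a \<times> 'a) *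
      (\<integral>z. gaussian (1 / e) (fst z - snd z) * inner (h (fst z)) (h (snd z)) \<partial>(lborel \<Otimes>\<^sub>M lborel))"
proof -
  have [measurable]: "h \<in> borel_measurable borel"
    using h by (auto dest: borel_measurable_integrable)
  let ?P = "lborel \<Otimes>\<^sub>M lborel :: (('a \<times> 'a) \<times> ('a \<times> 'a)) measure"
  let ?F = "\<lambda>w z. gaussian e w * inner (kern w (fst z) (h (fst z))) (kern w (snd z) (h (snd z)))"
  \<comment> \<open>The space of pairs is needed in two forms: as a product, to evaluate the double
    integral, and as one \<open>lborel\<close>, to be a factor of a further product.\<close>
  have P: "?P = lborel"
    by (rule lborel_prod)
  have int: "integrable (lborel \<Otimes>\<^sub>M lborel) (\<lambda>(w, z). ?F w z)"
  proof (rule Bochner_Integration.integrable_bound)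
    have "integrable ?P (\<lambda>z. norm (h (fst z)) * norm (h (snd z)))"
      using h by (intro lborel_pair.integrable_product_mult integrable_norm)
    then show "integrable (lborel \<Otimes>\<^sub>M lborel) (\<lambda>x. gaussian e (fst x) * (norm (h (fst (snd x))) * norm (h (snd (snd x)))))"
      unfolding P by (intro lborel_pair.integrable_product_mult integrable_gaussian e)
    show "(\<lambda>(w, z). ?F w z) \<in> borel_measurable (lborel \<Otimes>\<^sub>M lborel)"
      unfolding case_prod_beta by measurable
    have "\<bar>inner (kern w y (h y)) (kern w y' (h y'))\<bar> \<le> norm (h y) * norm (h y')" for w y y'
      using Cauchy_Schwarz_ineq2[of "kern w y (h y)" "kern w y' (h y')"] by simp
    then show "AE x in lborel \<Otimes>\<^sub>M lborel. norm (case x of (w, z) \<Rightarrow> ?F w z) \<le>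
        norm (gaussian e (fst x) * (norm (h (fst (snd x))) * norm (h (snd (snd x)))))"
      by (auto simp: case_prod_beta abs_mult intro!: mult_left_mono AE_I2)
  qed
  have inn: "(\<integral>z. ?F w z \<partial>lborel) = gaussian e w * (norm (qft h w))\<^sup>2" for w
    using integral_inner_product[OF integrable_kern[OF h, of w] integrable_kern[OF h, of w]]
    by (simp add: P power2_norm_eq_inner flip: qft_def)
  show "integrable lborel (\<lambda>w. gaussian e w * (norm (qft h w))\<^sup>2)"
    using lborel_pair.integrable_fst'[OF int] by (simp only: case_prod_conv inn)
  have "(\<integral>w. gaussian e w * (norm (qft h w))\<^sup>2 \<partial>lborel) = (\<integral>w. (\<integral>z. ?F w z \<partial>lborel) \<partial>lborel)"
    by (simp only: inn)
  also have "\<dots> = (\<integral>z. (\<integral>w. ?F w z \<partial>lborel) \<partial>lborel)"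
    by (rule lborel_pair.Fubini_integral[OF int, symmetric])
  also have "\<dots> = (sqrt (2 * pi) / e) ^ DIM('a \<times> 'a) *
      (\<integral>z. gaussian (1 / e) (fst z - snd z) * inner (h (fst z)) (h (snd z)) \<partial>lborel)"
    unfolding integral_gaussian_inner_kern[OF e] by simp
  finally show "(\<integral>w. gaussian e w * (norm (qft h w))\<^sup>2 \<partial>lborel) = (sqrt (2 * pi) / e) ^ DIM('a \<times> 'a) *
      (\<integral>z. gaussian (1 / e) (fst z - snd z) * inner (h (fst z)) (h (snd z)) \<partial>?P)"
    unfolding P .
qed

section \<open>Autocorrelation averaged against a Gaussian\<close>

lemma gaussian_shift:
  fixes g :: "'a::euclidean_space \<Rightarrow> real"
  assumes g: "integrable lborel g"
  shows "integrable (lborel \<Otimes>\<^sub>M lborel) (\<lambda>z. gaussian 1 (snd z) * g (fst z + e *\<^sub>R snd z))"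
    and "(\<integral>z. gaussian 1 (snd z) * g (fst z + e *\<^sub>R snd z) \<partial>(lborel \<Otimes>\<^sub>M lborel)) =
      sqrt (2 * pi) ^ DIM('a) * integral\<^sup>L lborel g"
proof -
  have [measurable]: "g \<in> borel_measurable borel"
    using g by (auto dest: borel_measurable_integrable)
  \<comment> \<open>The Gaussian variable comes first here, so that the inner integral runs over the
    shifted variable; translation invariance then removes the shift for every \<open>e\<close>, also
    for \<open>e = 0\<close>.\<close>
  define Q where "Q x = gaussian 1 (fst x) * g (snd x + e *\<^sub>R fst x)" for x :: "'a \<times> 'a"
  have Q: "integrable (lborel \<Otimes>\<^sub>M lborel) Q"
  proof (rule lborel_pair.Fubini_integrable)
    show "Q \<in> borel_measurable (lborel \<Otimes>\<^sub>M lborel)"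
      unfolding Q_def by measurable
    have "(\<integral>y. norm (Q (x, y)) \<partial>lborel) = gaussian 1 x * (\<integral>y. \<bar>g y\<bar> \<partial>lborel)" for x
      using integral_lborel_shift[of "\<lambda>y. \<bar>g y\<bar>" "e *\<^sub>R x"] by (simp add: Q_def abs_mult)
    then show "integrable lborel (\<lambda>x. \<integral>y. norm (Q (x, y)) \<partial>lborel)"
      by (simp add: integrable_gaussian)
    show "AE x in lborel. integrable lborel (\<lambda>y. Q (x, y))"
      by (simp add: Q_def integrable_lborel_shift g)
  qed
  show "integrable (lborel \<Otimes>\<^sub>M lborel) (\<lambda>z. gaussian 1 (snd z) * g (fst z + e *\<^sub>R snd z))"
    using lborel_pair.integrable_product_swap[OF Q] by (simp add: Q_def case_prod_unfold)
  have "(\<integral>z. gaussian 1 (snd z) * g (fst z + e *\<^sub>R snd z) \<partial>(lborel \<Otimes>\<^sub>M lborel)) =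
      integral\<^sup>L (lborel \<Otimes>\<^sub>M lborel) Q"
    using lborel_pair.integral_product_swap[OF borel_measurable_integrable[OF Q]]
    by (simp add: Q_def case_prod_unfold)
  also have "\<dots> = (\<integral>x. gaussian 1 (x::'a) * integral\<^sup>L lborel g \<partial>lborel)"
    by (simp add: lborel_pair.integral_fst'[OF Q, symmetric] Q_def integral_lborel_shift)
  also have "\<dots> = sqrt (2 * pi) ^ DIM('a) * integral\<^sup>L lborel g"
    by (simp add: integral_gaussian)
  finally show "(\<integral>z. gaussian 1 (snd z) * g (fst z + e *\<^sub>R snd z) \<partial>(lborel \<Otimes>\<^sub>M lborel)) =
      sqrt (2 * pi) ^ DIM('a) * integral\<^sup>L lborel g" .
qed

lemma inner_le_mean_square: "\<bar>inner x y\<bar> \<le> ((norm x)\<^sup>2 + (norm y)\<^sup>2) / 2"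
proof -
  have "0 \<le> (norm x - norm y)\<^sup>2" by simp
  then show ?thesis
    using Cauchy_Schwarz_ineq2[of x y] by (simp add: power2_diff)
qed

text \<open>The inner product is at most the mean of the two squared norms, and by
  \<open>gaussian_shift\<close>, used with shifts 0 and \<open>e\<close>, both have the same
  Gaussian average. The bound is therefore independent of \<open>e\<close>.\<close>

lemma gaussian_correlation:
  fixes h :: "'a::euclidean_space \<Rightarrow> 'b::euclidean_space"
  assumes [measurable]: "h \<in> borel_measurable borel" and sq: "integrable lborel (\<lambda>x. (norm (h x))\<^sup>2)"
  shows "integrable (lborel \<Otimes>\<^sub>M lborel) (\<lambda>z. gaussian 1 (snd z) * inner (h (fst z)) (h (fst z + e *\<^sub>R snd z)))"
    (is "integrable _ ?f")
    and "(\<integral>z. gaussian 1 (snd z) * inner (h (fst z)) (h (fst z + e *\<^sub>R snd z)) \<partial>(lborel \<Otimes>\<^sub>M lborel))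
      \<le> sqrt (2 * pi) ^ DIM('a) * (\<integral>x. (norm (h x))\<^sup>2 \<partial>lborel)"
proof -
  let ?g = "\<lambda>e z. gaussian 1 (snd z) * (norm (h (fst z + e *\<^sub>R snd z)))\<^sup>2"
  let ?b = "\<lambda>z. (?g 0 z + ?g e z) / 2"
  note g = gaussian_shift[OF sq]
  have b: "integrable (lborel \<Otimes>\<^sub>M lborel) ?b"
    by (intro Bochner_Integration.integrable_add integrable_divide_zero g)
  have le: "\<bar>?f z\<bar> \<le> ?b z" for z
    using mult_left_mono[OF inner_le_mean_square gaussian_nonneg, of 1 "snd z" "h (fst z)" "h (fst z + e *\<^sub>R snd z)"]
    by (simp add: abs_mult algebra_simps add_divide_distrib)
  show f: "integrable (lborel \<Otimes>\<^sub>M lborel) ?f"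
  proof (rule Bochner_Integration.integrable_bound[OF b])
    show "AE z in lborel \<Otimes>\<^sub>M lborel. norm (?f z) \<le> norm (?b z)"
      using le by (auto intro!: AE_I2 simp: order_trans[OF le abs_ge_self])
  qed measurable
  have "integral\<^sup>L (lborel \<Otimes>\<^sub>M lborel) ?f \<le> integral\<^sup>L (lborel \<Otimes>\<^sub>M lborel) ?b"
    by (intro integral_mono f b order_trans[OF abs_ge_self le])
  also have "\<dots> = sqrt (2 * pi) ^ DIM('a) * (\<integral>x. (norm (h x))\<^sup>2 \<partial>lborel)"
    using g[of 0] g[of e] by simp
  finally show "integral\<^sup>L (lborel \<Otimes>\<^sub>M lborel) ?f \<le> sqrt (2 * pi) ^ DIM('a) * (\<integral>x. (norm (h x))\<^sup>2 \<partial>lborel)" .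
qed

text \<open>The substitution \<open>y' = y + e *\<^sub>R z\<close> moves the parameter from the
  Gaussian into the argument of \<open>h\<close>, and its Jacobian cancels the power of
  \<open>e\<close> from the transformed Gaussian. The limit in \<open>e\<close> can now be taken
  under one fixed Gaussian.\<close>

lemma integral_gaussian_qft_correlation:
  fixes h :: "'a::euclidean_space \<times> 'a \<Rightarrow> quat"
  assumes e: "e > 0" and h: "integrable lborel h" and sq: "integrable lborel (\<lambda>x. (norm (h x))\<^sup>2)"
  shows "(\<integral>w. gaussian e w * (norm (qft h w))\<^sup>2 \<partial>lborel) = sqrt (2 * pi) ^ DIM('a \<times> 'a) *
    (\<integral>z. gaussian 1 (snd z) * inner (h (fst z)) (h (fst z + e *\<^sub>R snd z)) \<partial>(lborel \<Otimes>\<^sub>M lborel))"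
proof -
  have [measurable]: "h \<in> borel_measurable borel"
    using h by (auto dest: borel_measurable_integrable)
  let ?G = "\<lambda>z. gaussian (1 / e) (fst z - snd z) * inner (h (fst z)) (h (snd z))"
  have "integrable (lborel \<Otimes>\<^sub>M lborel) ?G"
  proof (rule Bochner_Integration.integrable_bound[OF integrable_inner_product[OF
          integrable_norm[OF h] integrable_norm[OF h]]])
    have "\<bar>?G z\<bar> \<le> 1 * (norm (h (fst z)) * norm (h (snd z)))" for z
      unfolding abs_mult by (intro mult_mono) (simp_all add: gaussian_le_1 Cauchy_Schwarz_ineq2)
    then show "AE z in lborel \<Otimes>\<^sub>M lborel. norm (?G z) \<le> norm (inner (norm (h (fst z))) (norm (h (snd z))))"
      by (auto simp: abs_mult)
  qed measurable
  then have "integral\<^sup>L (lborel \<Otimes>\<^sub>M lborel) ?G = (\<integral>y. (\<integral>y'. ?G (y, y') \<partial>lborel) \<partial>lborel)"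
    by (rule lborel_pair.integral_fst'[symmetric])
  also have "\<dots> = (\<integral>y. e ^ DIM('a \<times> 'a) * (\<integral>z. gaussian 1 z * inner (h y) (h (y + e *\<^sub>R z)) \<partial>lborel) \<partial>lborel)"
  proof (intro Bochner_Integration.integral_cong refl)
    fix y
    have "gaussian (1 / e) (y - (y + e *\<^sub>R z)) = gaussian 1 z" for z :: "'a \<times> 'a"
      using e by (simp add: gaussian_def)
    then show "(\<integral>y'. ?G (y, y') \<partial>lborel) =
        e ^ DIM('a \<times> 'a) * (\<integral>z. gaussian 1 z * inner (h y) (h (y + e *\<^sub>R z)) \<partial>lborel)"
      using e by (subst integral_lborel_affine[where c=e and t=y]) simp_all
  qed
  also have "\<dots> = e ^ DIM('a \<times> 'a) *
      (\<integral>z. gaussian 1 (snd z) * inner (h (fst z)) (h (fst z + e *\<^sub>R snd z)) \<partial>(lborel \<Otimes>\<^sub>M lborel))"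
    using lborel_pair.integral_fst'[OF gaussian_correlation(1)[OF _ sq]] by simp
  finally show ?thesis
    using e unfolding integral_gaussian_qft(2)[OF e h] by (simp add: power_divide)
qed

text \<open>One power comes from the Fourier transform of the damping Gaussian, the other from the
  mass of \<open>gaussian 1\<close>; together they form the Plancherel constant.\<close>

lemma sqrt_2pi_power: "sqrt (2 * pi) ^ n * (sqrt (2 * pi) ^ n * x) = (2 * pi) ^ n * x"
proof -
  have "sqrt (2 * pi) ^ n * sqrt (2 * pi) ^ n = (sqrt (2 * pi) * sqrt (2 * pi)) ^ n"
    by (rule power_mult_distrib[symmetric])
  also have "sqrt (2 * pi) * sqrt (2 * pi) = 2 * pi"
    by (rule real_sqrt_mult_self[THEN trans]) simp
  finally show ?thesis
    by (simp only: mult.assoc[symmetric])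
qed

section \<open>The limit of vanishing damping\<close>

lemma tendsto_inverse_Suc: "(\<lambda>k. 1 / real (Suc k)) \<longlonglongrightarrow> 0"
  using LIMSEQ_inverse_real_of_nat by (simp add: inverse_eq_divide)

lemma gaussian_tendsto_1:
  assumes "e \<longlonglongrightarrow> 0"
  shows "(\<lambda>k. gaussian (e k) x) \<longlonglongrightarrow> 1"
proof -
  have "(\<lambda>k. exp (- (e k * norm x)\<^sup>2 / 2)) \<longlonglongrightarrow> exp (- (0 * norm x)\<^sup>2 / 2)"
    by (intro tendsto_intros assms) simp
  then show ?thesis by (simp add: gaussian_def)
qed

text \<open>The bound by \<open>C\<close> is uniform in \<open>e\<close>, so Fatou's lemma for the
  nonnegative integral yields square integrability of the transform as well. Without it a bound on
  the Bochner integral, which is 0 for non-integrable functions, would say nothing.\<close>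

lemma qft_contraction:
  fixes h :: "'a::euclidean_space \<times> 'a \<Rightarrow> quat"
  assumes h: "integrable lborel h" and sq: "integrable lborel (\<lambda>x. (norm (h x))\<^sup>2)"
  shows "integrable lborel (\<lambda>w. (norm (qft h w))\<^sup>2)"
    and "(\<integral>w. (norm (qft h w))\<^sup>2 \<partial>lborel) \<le> (2 * pi) ^ DIM('a \<times> 'a) * (\<integral>y. (norm (h y))\<^sup>2 \<partial>lborel)"
proof -
  have [measurable]: "h \<in> borel_measurable borel"
    using h by (auto dest: borel_measurable_integrable)
  define C where "C = (2 * pi) ^ DIM('a \<times> 'a) * (\<integral>y. (norm (h y))\<^sup>2 \<partial>lborel)"
  have C: "(\<integral>w. gaussian e w * (norm (qft h w))\<^sup>2 \<partial>lborel) \<le> C" if "e > 0" for e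
    unfolding integral_gaussian_qft_correlation[OF that h sq] C_def
    using mult_left_mono[OF gaussian_correlation(2)[OF _ sq], of "sqrt (2 * pi) ^ DIM('a \<times> 'a)" e]
    by (simp only: sqrt_2pi_power) simp
  define e where "e k = 1 / real (Suc k)" for k
  have lim: "(\<lambda>k. ennreal (gaussian (e k) w * (norm (qft h w))\<^sup>2)) \<longlonglongrightarrow> ennreal (1 * (norm (qft h w))\<^sup>2)" for w
    unfolding e_def by (intro tendsto_ennrealI tendsto_mult gaussian_tendsto_1 tendsto_inverse_Suc tendsto_const)
  have "liminf (\<lambda>k. ennreal (gaussian (e k) w * (norm (qft h w))\<^sup>2)) = ennreal ((norm (qft h w))\<^sup>2)" for w
    using lim_imp_Liminf[OF sequentially_bot lim[of w]] by (simp only: mult_1)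
  then have "(\<integral>\<^sup>+w. (norm (qft h w))\<^sup>2 \<partial>lborel) =
      (\<integral>\<^sup>+w. liminf (\<lambda>k. ennreal (gaussian (e k) w * (norm (qft h w))\<^sup>2)) \<partial>lborel)"
    by (simp only:)
  also have "\<dots> \<le> liminf (\<lambda>k. \<integral>\<^sup>+w. ennreal (gaussian (e k) w * (norm (qft h w))\<^sup>2) \<partial>lborel)"
    by (rule nn_integral_liminf) measurable
  also have "\<dots> \<le> liminf (\<lambda>k. ennreal C)"
  proof (intro Liminf_mono always_eventually allI)
    fix k
    have k: "e k > 0" by (simp add: e_def)
    show "(\<integral>\<^sup>+w. ennreal (gaussian (e k) w * (norm (qft h w))\<^sup>2) \<partial>lborel) \<le> ennreal C"
      using C[OF k] by (subst nn_integral_eq_integral[OF integral_gaussian_qft(1)[OF k h]])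
        (auto intro: ennreal_leI)
  qed
  also have "\<dots> = ennreal C"
    by (simp add: Liminf_const)
  finally have le: "(\<integral>\<^sup>+w. (norm (qft h w))\<^sup>2 \<partial>lborel) \<le> ennreal C" .
  then show int: "integrable lborel (\<lambda>w. (norm (qft h w))\<^sup>2)"
    by (intro integrableI_bounded) (auto intro: le_less_trans)
  have "C \<ge> 0"
    by (simp add: C_def)
  then show "(\<integral>w. (norm (qft h w))\<^sup>2 \<partial>lborel) \<le> C"
    using le by (simp add: nn_integral_eq_integral[OF int])
qed

text \<open>Continuity gives pointwise convergence of the correlation integrand and boundedness an
  integrable majorant, so the limit of the damped energies is known. As \<open>gaussian\<close> is
  at most 1, none of them exceeds the full energy.\<close>

lemma qft_isometry_continuous:
  fixes h :: "'a::euclidean_space \<times> 'a \<Rightarrow> quat"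
  assumes cont: "continuous_on UNIV h" and bd: "\<And>y. norm (h y) \<le> M" and h: "integrable lborel h"
    and sq: "integrable lborel (\<lambda>x. (norm (h x))\<^sup>2)"
  shows "(\<integral>w. (norm (qft h w))\<^sup>2 \<partial>lborel) = (2 * pi) ^ DIM('a \<times> 'a) * (\<integral>y. (norm (h y))\<^sup>2 \<partial>lborel)"
proof (rule antisym[OF qft_contraction(2)[OF h sq]])
  have [measurable]: "h \<in> borel_measurable borel"
    using h by (auto dest: borel_measurable_integrable)
  let ?c = "sqrt (2 * pi) ^ DIM('a \<times> 'a)"
  let ?f = "\<lambda>e z. gaussian 1 (snd z) * inner (h (fst z)) (h (fst z + e *\<^sub>R snd z))"
  define e where "e k = 1 / real (Suc k)" for k
  have e0: "e \<longlonglongrightarrow> 0"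
    unfolding e_def by (rule tendsto_inverse_Suc)
  have "(\<lambda>k. integral\<^sup>L (lborel \<Otimes>\<^sub>M lborel) (?f (e k))) \<longlonglongrightarrow> integral\<^sup>L (lborel \<Otimes>\<^sub>M lborel) (?f 0)"
  proof (rule integral_dominated_convergence)
    show "integrable (lborel \<Otimes>\<^sub>M lborel) (\<lambda>z. norm (h (fst z)) * (M * gaussian 1 (snd z)))"
      using h by (intro lborel_pair.integrable_product_mult) (auto intro: integrable_gaussian)
    show "AE z in lborel \<Otimes>\<^sub>M lborel. (\<lambda>k. ?f (e k) z) \<longlonglongrightarrow> ?f 0 z"
    proof (intro AE_I2 tendsto_mult tendsto_inner tendsto_const)
      fix z :: "('a \<times> 'a) \<times> ('a \<times> 'a)"
      have "(\<lambda>k. fst z + e k *\<^sub>R snd z) \<longlonglongrightarrow> fst z + 0 *\<^sub>R snd z"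
        by (intro tendsto_intros e0)
      then show "(\<lambda>k. h (fst z + e k *\<^sub>R snd z)) \<longlonglongrightarrow> h (fst z + 0 *\<^sub>R snd z)"
        by (rule continuous_on_tendsto_compose[OF cont]) auto
    qed
    have "\<bar>?f e z\<bar> \<le> gaussian 1 (snd z) * (norm (h (fst z)) * M)" for e z
      unfolding abs_mult
      by (intro mult_mono order_trans[OF Cauchy_Schwarz_ineq2] bd) (simp_all add: bd)
    then show "AE z in lborel \<Otimes>\<^sub>M lborel. norm (?f (e k) z) \<le> norm (h (fst z)) * (M * gaussian 1 (snd z))" for k
      by (simp add: mult_ac)
  qed measurable
  moreover have "integral\<^sup>L (lborel \<Otimes>\<^sub>M lborel) (?f 0) = ?c * (\<integral>y. (norm (h y))\<^sup>2 \<partial>lborel)"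
    using gaussian_shift(2)[OF sq, of 0] by (simp add: power2_norm_eq_inner)
  ultimately have lim: "(\<lambda>k. ?c * integral\<^sup>L (lborel \<Otimes>\<^sub>M lborel) (?f (e k))) \<longlonglongrightarrow>
      ?c * (?c * (\<integral>y. (norm (h y))\<^sup>2 \<partial>lborel))"
    by (auto intro: tendsto_mult_left)
  have le: "?c * integral\<^sup>L (lborel \<Otimes>\<^sub>M lborel) (?f (e k)) \<le> (\<integral>w. (norm (qft h w))\<^sup>2 \<partial>lborel)" for k
  proof -
    have k: "e k > 0" by (simp add: e_def)
    show ?thesis
      unfolding integral_gaussian_qft_correlation[OF k h sq, symmetric]
      by (intro integral_mono integral_gaussian_qft[OF k h] qft_contraction[OF h sq] mult_left_le_one_le)
        (simp_all add: gaussian_le_1)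
  qed
  have "?c * (?c * (\<integral>y. (norm (h y))\<^sup>2 \<partial>lborel)) \<le> (\<integral>w. (norm (qft h w))\<^sup>2 \<partial>lborel)"
    by (rule LIMSEQ_le_const2[OF lim]) (simp only: le simp_thms)
  then show "(2 * pi) ^ DIM('a \<times> 'a) * (\<integral>y. (norm (h y))\<^sup>2 \<partial>lborel) \<le> (\<integral>w. (norm (qft h w))\<^sup>2 \<partial>lborel)"
    by (simp only: sqrt_2pi_power)
qed

section \<open>Density and Plancherel identity\<close>

lemma norm_add_square_le: "(norm (x + y))\<^sup>2 \<le> 2 * (norm x)\<^sup>2 + 2 * (norm (y::'a::real_inner))\<^sup>2"
proof -
  have "(norm (x + y))\<^sup>2 + (norm (x - y))\<^sup>2 = 2 * (norm x)\<^sup>2 + 2 * (norm y)\<^sup>2"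
    by (simp add: power2_norm_eq_inner algebra_simps inner_commute)
  then show ?thesis
    by (smt (verit) zero_le_power2)
qed

lemma integrable_norm_square_add:
  fixes f g :: "'a \<Rightarrow> 'b::euclidean_space"
  assumes [measurable]: "f \<in> borel_measurable M" "g \<in> borel_measurable M"
    and f: "integrable M (\<lambda>x. (norm (f x))\<^sup>2)" and g: "integrable M (\<lambda>x. (norm (g x))\<^sup>2)"
  shows "integrable M (\<lambda>x. (norm (f x + g x))\<^sup>2)"
proof (rule Bochner_Integration.integrable_bound)
  show "integrable M (\<lambda>x. 2 * (norm (f x))\<^sup>2 + 2 * (norm (g x))\<^sup>2)"
    using f g by simp
  show "AE x in M. norm ((norm (f x + g x))\<^sup>2) \<le> norm (2 * (norm (f x))\<^sup>2 + 2 * (norm (g x))\<^sup>2)"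
    by (intro AE_I2) (simp add: norm_add_square_le)
qed measurable

lemma integrable_norm_square_diff:
  fixes f g :: "'a \<Rightarrow> 'b::euclidean_space"
  assumes "f \<in> borel_measurable M" "g \<in> borel_measurable M"
    and "integrable M (\<lambda>x. (norm (f x))\<^sup>2)" and "integrable M (\<lambda>x. (norm (g x))\<^sup>2)"
  shows "integrable M (\<lambda>x. (norm (f x - g x))\<^sup>2)"
  using integrable_norm_square_add[of f M "\<lambda>x. - g x"] assms by simp

text \<open>Write \<open>a\<close> as \<open>b + (a - b)\<close> and apply Young's inequality to the
  cross term with weights \<open>d\<close> and \<open>1 / d\<close>. A small \<open>d\<close>
  controls the part with the fixed function, at the price of a large factor on the part that tends
  to 0.\<close>

lemma norm_square_diff_le:
  fixes a b :: "'a::real_inner"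
  assumes d: "d > 0"
  shows "\<bar>(norm a)\<^sup>2 - (norm b)\<^sup>2\<bar> \<le> (1 + 1 / d) * (norm (a - b))\<^sup>2 + d * (norm b)\<^sup>2"
proof -
  have "\<bar>inner b (a - b)\<bar> = \<bar>inner (sqrt d *\<^sub>R b) ((1 / sqrt d) *\<^sub>R (a - b))\<bar>"
    using d by simp
  also have "\<dots> \<le> (d * (norm b)\<^sup>2 + 1 / d * (norm (a - b))\<^sup>2) / 2"
    using inner_le_mean_square[of "sqrt d *\<^sub>R b" "(1 / sqrt d) *\<^sub>R (a - b)"] d
    by (simp add: power_mult_distrib power_divide)
  finally have "2 * \<bar>inner b (a - b)\<bar> \<le> d * (norm b)\<^sup>2 + 1 / d * (norm (a - b))\<^sup>2" by simp
  moreover have "(norm a)\<^sup>2 - (norm b)\<^sup>2 = (norm (a - b))\<^sup>2 + 2 * inner b (a - b)"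
    by (simp add: power2_norm_eq_inner algebra_simps inner_commute)
  moreover have "0 \<le> (norm (a - b))\<^sup>2" by simp
  ultimately show ?thesis
    unfolding distrib_right by linarith
qed

lemma tendsto_integral_norm_square:
  fixes f :: "nat \<Rightarrow> 'a \<Rightarrow> 'b::euclidean_space"
  assumes [measurable]: "\<And>k. f k \<in> borel_measurable M" "g \<in> borel_measurable M"
    and f: "\<And>k. integrable M (\<lambda>x. (norm (f k x))\<^sup>2)" and g: "integrable M (\<lambda>x. (norm (g x))\<^sup>2)"
    and lim: "(\<lambda>k. \<integral>x. (norm (f k x - g x))\<^sup>2 \<partial>M) \<longlonglongrightarrow> 0"
  shows "(\<lambda>k. \<integral>x. (norm (f k x))\<^sup>2 \<partial>M) \<longlonglongrightarrow> (\<integral>x. (norm (g x))\<^sup>2 \<partial>M)"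
proof (rule LIMSEQ_I)
  fix r :: real assume r: "r > 0"
  define B where "B = (\<integral>x. (norm (g x))\<^sup>2 \<partial>M)"
  have B: "B \<ge> 0" by (simp add: B_def)
  \<comment> \<open>\<open>B + 1\<close> instead of \<open>B\<close> keeps the denominator positive
    when \<open>g\<close> vanishes almost everywhere.\<close>
  define d where "d = r / (2 * (B + 1))"
  have d: "d > 0" using B r by (simp add: d_def)
  have dB: "d * B < r / 2"
    using B r by (simp add: d_def field_simps)
  note int = integrable_norm_square_diff[OF assms(1,2) f g]
  have le: "\<bar>(\<integral>x. (norm (f k x))\<^sup>2 \<partial>M) - B\<bar> \<le> (1 + 1 / d) * (\<integral>x. (norm (f k x - g x))\<^sup>2 \<partial>M) + d * B" for k
  proof -
    have "\<bar>(\<integral>x. (norm (f k x))\<^sup>2 \<partial>M) - B\<bar> = \<bar>\<integral>x. (norm (f k x))\<^sup>2 - (norm (g x))\<^sup>2 \<partial>M\<bar>"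
      using f g by (simp add: B_def)
    also have "\<dots> \<le> (\<integral>x. \<bar>(norm (f k x))\<^sup>2 - (norm (g x))\<^sup>2\<bar> \<partial>M)"
      by (rule integral_abs_bound)
    also have "\<dots> \<le> (\<integral>x. (1 + 1 / d) * (norm (f k x - g x))\<^sup>2 + d * (norm (g x))\<^sup>2 \<partial>M)"
      using f g int d by (intro integral_mono norm_square_diff_le) auto
    also have "\<dots> = (1 + 1 / d) * (\<integral>x. (norm (f k x - g x))\<^sup>2 \<partial>M) + d * B"
      using g int by (simp add: B_def)
    finally show ?thesis .
  qed
  have "(\<lambda>k. (1 + 1 / d) * (\<integral>x. (norm (f k x - g x))\<^sup>2 \<partial>M)) \<longlonglongrightarrow> (1 + 1 / d) * 0"
    by (intro tendsto_intros lim)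
  then have "\<forall>\<^sub>F k in sequentially. (1 + 1 / d) * (\<integral>x. (norm (f k x - g x))\<^sup>2 \<partial>M) < r / 2"
    using r by (intro order_tendstoD(2)) auto
  then obtain K where K: "\<And>k. k \<ge> K \<Longrightarrow> (1 + 1 / d) * (\<integral>x. (norm (f k x - g x))\<^sup>2 \<partial>M) < r / 2"
    unfolding eventually_sequentially by blast
  have "norm ((\<integral>x. (norm (f k x))\<^sup>2 \<partial>M) - B) < r" if "k \<ge> K" for k
    using order_le_less_trans[OF le add_strict_mono[OF K[OF that] dB]] by simp
  then show "\<exists>no. \<forall>n\<ge>no. norm ((\<integral>x. (norm (f n x))\<^sup>2 \<partial>M) - (\<integral>x. (norm (g x))\<^sup>2 \<partial>M)) < r"
    unfolding B_def by blast
qed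

text \<open>Measurability provides continuous functions \<open>g n\<close> converging almost
  everywhere to \<open>h\<close>, with no control on size or support. Projecting their values to a
  ball and multiplying by a cutoff supplies both, which makes dominated convergence
  applicable.\<close>

lemma continuous_approx_bounded_support:
  fixes h :: "'a::euclidean_space \<Rightarrow> 'b::euclidean_space"
  assumes meas [measurable]: "h \<in> borel_measurable borel" and R: "R \<ge> 0"
    and bd: "\<And>y. norm (h y) \<le> R" and supp: "\<And>y. norm y > R \<Longrightarrow> h y = 0" and d: "d > 0"
  obtains \<phi> where "continuous_on UNIV \<phi>" "\<And>y. norm (\<phi> y) \<le> R" "integrable lborel \<phi>"
    "integrable lborel (\<lambda>y. (norm (\<phi> y))\<^sup>2)" "(\<integral>y. (norm (\<phi> y - h y))\<^sup>2 \<partial>lborel) < d"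
proof -
  have "h measurable_on UNIV"
    by (intro lebesgue_measurable_imp_measurable_on measurable_completion) simp_all
  then obtain N g where N: "negligible N" and cont: "\<And>n. continuous_on UNIV (g n)"
    and lim: "\<And>x. x \<notin> N \<Longrightarrow> (\<lambda>n. g n x) \<longlonglongrightarrow> h x"
    unfolding measurable_on_def by auto
  define \<psi> :: "'a \<Rightarrow> real" where "\<psi> y = max 0 (min 1 (R + 1 - norm y))" for y
  \<comment> \<open>The nearest-point projection is a continuous retraction onto the ball that
    contains all values of \<open>h\<close>, so it leaves the limit unchanged.\<close>
  define cp :: "'b \<Rightarrow> 'b" where "cp = closest_point (cball 0 R)"
  define \<phi> where "\<phi> n y = \<psi> y *\<^sub>R cp (g n y)" for n y
  have cp_cont: "continuous_on UNIV cp"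
    unfolding cp_def using R by (intro continuous_on_closest_point) auto
  have \<psi>: "0 \<le> \<psi> y" "\<psi> y \<le> 1" "norm y \<le> R \<Longrightarrow> \<psi> y = 1" "norm y > R + 1 \<Longrightarrow> \<psi> y = 0" for y
    by (auto simp: \<psi>_def)
  have cp_norm: "norm (cp q) \<le> R" for q
    using closest_point_in_set[of "cball 0 R" q] R by (simp add: cp_def)
  have \<phi>_cont: "continuous_on UNIV (\<phi> n)" for n
    unfolding \<phi>_def \<psi>_def
    by (intro continuous_intros continuous_on_compose2[OF cp_cont] cont) auto
  then have [measurable]: "\<phi> n \<in> borel_measurable borel" for n
    by (rule borel_measurable_continuous_onI)
  have \<phi>_le: "norm (\<phi> n y) \<le> R" for n y
    using mult_mono[OF \<psi>(2)[of y] cp_norm[of "g n y"]] \<psi>(1)[of y] by (simp add: \<phi>_def)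
  have \<phi>_supp: "\<phi> n y = 0" if "y \<notin> cball 0 (R + 1)" for n y
    using that \<psi>(4)[of y] by (simp add: \<phi>_def)
  have h_supp: "h y = 0" if "y \<notin> cball 0 (R + 1)" for y
    using that supp[of y] by simp
  have ind: "integrable lborel (\<lambda>y. c * indicator (cball 0 (R + 1)) (y::'a))" for c :: real
    using emeasure_lborel_cball_finite[of "0::'a" "R + 1"] by simp
  have int: "integrable lborel (\<phi> n)" for n
  proof (rule Bochner_Integration.integrable_bound[OF ind[of R]])
    show "AE y in lborel. norm (\<phi> n y) \<le> norm (R * indicator (cball 0 (R + 1)) y)"
      using \<phi>_le \<phi>_supp R by (auto simp: indicator_def)
  qed measurable
  have int2: "integrable lborel (\<lambda>y. (norm (\<phi> n y))\<^sup>2)" for n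
  proof (rule Bochner_Integration.integrable_bound[OF ind[of "R\<^sup>2"]])
    show "AE y in lborel. norm ((norm (\<phi> n y))\<^sup>2) \<le> norm (R\<^sup>2 * indicator (cball 0 (R + 1)) y)"
      using \<phi>_le \<phi>_supp R by (auto simp: indicator_def intro: power_mono)
  qed measurable
  have "(\<lambda>n. \<integral>y. (norm (\<phi> n y - h y))\<^sup>2 \<partial>lborel) \<longlonglongrightarrow> (\<integral>y. 0 \<partial>(lborel::'a measure))"
  proof (rule integral_dominated_convergence[OF _ _ ind[of "(2 * R)\<^sup>2"]])
    have "AE y in lborel. y \<notin> N"
      using N AE_not_in[of N lebesgue] by (simp add: negligible_iff_null_sets AE_completion_iff)
    then show "AE y in lborel. (\<lambda>n. (norm (\<phi> n y - h y))\<^sup>2) \<longlonglongrightarrow> 0"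
    proof eventually_elim
      case (elim y)
      have "(\<lambda>n. cp (g n y)) \<longlonglongrightarrow> cp (h y)"
        by (rule continuous_on_tendsto_compose[OF cp_cont lim[OF elim]]) auto
      then have "(\<lambda>n. \<phi> n y) \<longlonglongrightarrow> \<psi> y *\<^sub>R cp (h y)"
        unfolding \<phi>_def by (intro tendsto_intros)
      \<comment> \<open>Beyond radius \<open>R\<close> the cutoff differs from 1, but there
        \<open>h y\<close> is 0, which \<open>cp\<close> fixes.\<close>
      moreover have "\<psi> y *\<^sub>R cp (h y) = h y"
        using bd[of y] supp[of y] \<psi>(3)[of y] by (cases "norm y \<le> R") (auto simp: cp_def closest_point_self R)
      ultimately have "(\<lambda>n. (norm (\<phi> n y - h y))\<^sup>2) \<longlonglongrightarrow> (norm (h y - h y))\<^sup>2"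
        by (intro tendsto_intros) simp
      then show ?case by simp
    qed
    have "norm (\<phi> n y - h y) \<le> 2 * R" for n y
      using norm_triangle_ineq4[of "\<phi> n y" "h y"] \<phi>_le[of n y] bd[of y] by simp
    then have "(norm (\<phi> n y - h y))\<^sup>2 \<le> (2 * R)\<^sup>2" for n y
      by (rule power_mono) simp
    then show "AE y in lborel. norm ((norm (\<phi> n y - h y))\<^sup>2) \<le> (2 * R)\<^sup>2 * indicator (cball 0 (R + 1)) y" for n
      using \<phi>_supp h_supp by (auto simp: indicator_def simp del: power_mult_distrib)
  qed measurable
  then have "\<forall>\<^sub>F n in sequentially. (\<integral>y. (norm (\<phi> n y - h y))\<^sup>2 \<partial>lborel) < d"
    using d by (intro order_tendstoD(2)) auto
  then obtain n where "(\<integral>y. (norm (\<phi> n y - h y))\<^sup>2 \<partial>lborel) < d"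
    unfolding eventually_sequentially by blast
  then show thesis
    using that[of "\<phi> n"] \<phi>_cont \<phi>_le int int2 by blast
qed

text \<open>Truncating argument and value at the same level \<open>k\<close> meets both requirements
  of the bounded case, and the error is dominated by \<open>(norm (h y))\<^sup>2\<close>.\<close>

lemma continuous_approx_L2:
  fixes h :: "'a::euclidean_space \<Rightarrow> 'b::euclidean_space"
  assumes meas [measurable]: "h \<in> borel_measurable borel"
    and sq: "integrable lborel (\<lambda>y. (norm (h y))\<^sup>2)" and d: "d > 0"
  obtains \<phi> M where "continuous_on UNIV \<phi>" "\<And>y. norm (\<phi> y) \<le> M" "integrable lborel \<phi>"
    "integrable lborel (\<lambda>y. (norm (\<phi> y))\<^sup>2)" "(\<integral>y. (norm (\<phi> y - h y))\<^sup>2 \<partial>lborel) < d"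
proof -
  define H where "H k y = (if norm y \<le> real k \<and> norm (h y) \<le> real k then h y else 0)" for k :: nat and y
  have [measurable]: "H k \<in> borel_measurable borel" for k
    unfolding H_def by measurable
  have H_le: "norm (H k y) \<le> norm (h y)" for k y
    by (simp add: H_def)
  have Hsq: "integrable lborel (\<lambda>y. (norm (H k y))\<^sup>2)" for k
    by (rule Bochner_Integration.integrable_bound[OF sq]) (auto simp: H_def)
  have "(\<lambda>k. \<integral>y. (norm (H k y - h y))\<^sup>2 \<partial>lborel) \<longlonglongrightarrow> (\<integral>y. 0 \<partial>(lborel::'a measure))"
  proof (rule integral_dominated_convergence[OF _ _ sq])
    have "(\<lambda>k. (norm (H k y - h y))\<^sup>2) \<longlonglongrightarrow> 0" for y
    proof (rule tendsto_eventually)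
      obtain K where "max (norm y) (norm (h y)) \<le> real K"
        using real_arch_simple by blast
      then have "H k y = h y" if "k \<ge> K" for k
        using that by (auto simp: H_def)
      then show "\<forall>\<^sub>F k in sequentially. (norm (H k y - h y))\<^sup>2 = 0"
        by (auto simp: eventually_sequentially)
    qed
    then show "AE y in lborel. (\<lambda>k. (norm (H k y - h y))\<^sup>2) \<longlonglongrightarrow> 0" by simp
    show "AE y in lborel. norm ((norm (H k y - h y))\<^sup>2) \<le> (norm (h y))\<^sup>2" for k
      by (simp add: H_def)
  qed measurable
  \<comment> \<open>A quarter each, since \<open>norm_add_square_le\<close> doubles the two errors
    that are added below.\<close>
  then have "\<forall>\<^sub>F n in sequentially. (\<integral>y. (norm (H n y - h y))\<^sup>2 \<partial>lborel) < d / 4"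
    using d by (intro order_tendstoD(2)) auto
  then obtain k where k: "(\<integral>y. (norm (H k y - h y))\<^sup>2 \<partial>lborel) < d / 4"
    unfolding eventually_sequentially by blast
  obtain \<phi> where \<phi>: "continuous_on UNIV \<phi>" "\<And>y. norm (\<phi> y) \<le> real k" "integrable lborel \<phi>"
    "integrable lborel (\<lambda>y. (norm (\<phi> y))\<^sup>2)" "(\<integral>y. (norm (\<phi> y - H k y))\<^sup>2 \<partial>lborel) < d / 4"
  proof (rule continuous_approx_bounded_support[of "H k" "real k" "d / 4"])
    show "norm (H k y) \<le> real k" for y by (simp add: H_def)
    show "H k y = 0" if "norm y > real k" for y using that by (simp add: H_def)
  qed (use d in auto)
  have [measurable]: "\<phi> \<in> borel_measurable borel"
    using \<phi>(1) by (rule borel_measurable_continuous_onI)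
  have i1: "integrable lborel (\<lambda>y. (norm (\<phi> y - H k y))\<^sup>2)"
    by (intro integrable_norm_square_diff \<phi> Hsq) simp_all
  have i2: "integrable lborel (\<lambda>y. (norm (H k y - h y))\<^sup>2)"
    by (intro integrable_norm_square_diff sq Hsq) simp_all
  have i3: "integrable lborel (\<lambda>y. (norm (\<phi> y - h y))\<^sup>2)"
    by (intro integrable_norm_square_diff \<phi> sq) simp_all
  have "(\<integral>y. (norm (\<phi> y - h y))\<^sup>2 \<partial>lborel) \<le>
      (\<integral>y. 2 * (norm (\<phi> y - H k y))\<^sup>2 + 2 * (norm (H k y - h y))\<^sup>2 \<partial>lborel)"
  proof (rule integral_mono[OF i3])
    show "(norm (\<phi> y - h y))\<^sup>2 \<le> 2 * (norm (\<phi> y - H k y))\<^sup>2 + 2 * (norm (H k y - h y))\<^sup>2" for y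
      using norm_add_square_le[of "\<phi> y - H k y" "H k y - h y"] by simp
  qed (use i1 i2 in simp)
  also have "\<dots> < d"
    using i1 i2 k \<phi>(5) by simp
  finally show thesis
    using that \<phi> by blast
qed

section \<open>Plancherel's and Parseval's identities\<close>

lemma qft_diff:
  assumes "integrable lborel f" "integrable lborel g"
  shows "qft (\<lambda>y. f y - g y) w = qft f w - qft g w"
  unfolding qft_def kern_diff
  by (intro Bochner_Integration.integral_diff integrable_kern assms)

lemma qft_add:
  assumes "integrable lborel f" "integrable lborel g"
  shows "qft (\<lambda>y. f y + g y) w = qft f w + qft g w"
  unfolding qft_def kern_add
  by (intro Bochner_Integration.integral_add integrable_kern assms)

theorem qft_plancherel:
  fixes h :: "'a::euclidean_space \<times> 'a \<Rightarrow> quat"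
  assumes h: "integrable lborel h" and sq: "integrable lborel (\<lambda>x. (norm (h x))\<^sup>2)"
  shows "(\<integral>w. (norm (qft h w))\<^sup>2 \<partial>lborel) = (2 * pi) ^ DIM('a \<times> 'a) * (\<integral>y. (norm (h y))\<^sup>2 \<partial>lborel)"
proof -
  have hm [measurable]: "h \<in> borel_measurable borel"
    using h by (auto dest: borel_measurable_integrable)
  let ?c = "(2 * pi) ^ DIM('a \<times> 'a) :: real"
  define P where "P d \<phi> \<longleftrightarrow> continuous_on UNIV \<phi> \<and> (\<exists>M. \<forall>y. norm (\<phi> y) \<le> M) \<and> integrable lborel \<phi> \<and>
    integrable lborel (\<lambda>y. (norm (\<phi> y))\<^sup>2) \<and> (\<integral>y. (norm (\<phi> y - h y))\<^sup>2 \<partial>lborel) < d" for d \<phi>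
  have "\<exists>\<phi>. P d \<phi>" if "d > 0" for d
    by (rule continuous_approx_L2[OF hm sq that]) (auto simp: P_def)
  then have "\<forall>k. \<exists>\<phi>. P (1 / real (Suc k)) \<phi>"
    by simp
  then obtain \<phi> where P: "\<And>k. P (1 / real (Suc k)) (\<phi> k)"
    by metis
  then have \<phi>: "continuous_on UNIV (\<phi> k)" "\<exists>M. \<forall>y. norm (\<phi> k y) \<le> M" "integrable lborel (\<phi> k)"
      "integrable lborel (\<lambda>y. (norm (\<phi> k y))\<^sup>2)"
    and lt: "(\<integral>y. (norm (\<phi> k y - h y))\<^sup>2 \<partial>lborel) < 1 / real (Suc k)" for k
    unfolding P_def by simp_all
  have iso: "(\<integral>w. (norm (qft (\<phi> k) w))\<^sup>2 \<partial>lborel) = ?c * (\<integral>y. (norm (\<phi> k y))\<^sup>2 \<partial>lborel)" for k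
    using \<phi>(2)[of k] qft_isometry_continuous[OF \<phi>(1) _ \<phi>(3,4)] by blast
  have m [measurable]: "\<phi> k \<in> borel_measurable borel" for k
    using \<phi>(1) by (rule borel_measurable_continuous_onI)
  have lim: "(\<lambda>k. \<integral>y. (norm (\<phi> k y - h y))\<^sup>2 \<partial>lborel) \<longlonglongrightarrow> 0"
  proof (rule tendsto_sandwich[OF _ _ tendsto_const tendsto_inverse_Suc])
    show "\<forall>\<^sub>F k in sequentially. (\<integral>y. (norm (\<phi> k y - h y))\<^sup>2 \<partial>lborel) \<le> 1 / real (Suc k)"
      using lt by (auto intro!: always_eventually less_imp_le)
  qed simp
  have 1: "(\<lambda>k. \<integral>y. (norm (\<phi> k y))\<^sup>2 \<partial>lborel) \<longlonglongrightarrow> (\<integral>y. (norm (h y))\<^sup>2 \<partial>lborel)"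
    by (rule tendsto_integral_norm_square) (simp_all add: \<phi> sq lim)
  have "(\<lambda>k. \<integral>w. (norm (qft (\<phi> k) w - qft h w))\<^sup>2 \<partial>lborel) \<longlonglongrightarrow> 0"
  proof (rule tendsto_sandwich[OF _ _ tendsto_const])
    show "(\<lambda>k. ?c * (\<integral>y. (norm (\<phi> k y - h y))\<^sup>2 \<partial>lborel)) \<longlonglongrightarrow> 0"
      using tendsto_mult_left[OF lim, of ?c] by simp
    have "(\<integral>w. (norm (qft (\<phi> k) w - qft h w))\<^sup>2 \<partial>lborel) \<le> ?c * (\<integral>y. (norm (\<phi> k y - h y))\<^sup>2 \<partial>lborel)" for k
      unfolding qft_diff[OF \<phi>(3) h, symmetric]
      by (intro qft_contraction(2) Bochner_Integration.integrable_diff integrable_norm_square_diff \<phi> h sq) simp_all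
    then show "\<forall>\<^sub>F k in sequentially. (\<integral>w. (norm (qft (\<phi> k) w - qft h w))\<^sup>2 \<partial>lborel)
        \<le> ?c * (\<integral>y. (norm (\<phi> k y - h y))\<^sup>2 \<partial>lborel)"
      by simp
  qed simp
  then have "(\<lambda>k. \<integral>w. (norm (qft (\<phi> k) w))\<^sup>2 \<partial>lborel) \<longlonglongrightarrow> (\<integral>w. (norm (qft h w))\<^sup>2 \<partial>lborel)"
    by (intro tendsto_integral_norm_square) (simp_all add: qft_contraction(1) \<phi> h sq)
  moreover have "(\<lambda>k. \<integral>w. (norm (qft (\<phi> k) w))\<^sup>2 \<partial>lborel) \<longlonglongrightarrow> ?c * (\<integral>y. (norm (h y))\<^sup>2 \<partial>lborel)"
    unfolding iso by (intro tendsto_mult_left 1)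
  ultimately show ?thesis
    by (rule LIMSEQ_unique)
qed

lemma integrable_inner_L2:
  fixes f g :: "'a \<Rightarrow> 'b::euclidean_space"
  assumes [measurable]: "f \<in> borel_measurable M" "g \<in> borel_measurable M"
    and f: "integrable M (\<lambda>x. (norm (f x))\<^sup>2)" and g: "integrable M (\<lambda>x. (norm (g x))\<^sup>2)"
  shows "integrable M (\<lambda>x. inner (f x) (g x))"
proof (rule Bochner_Integration.integrable_bound)
  show "integrable M (\<lambda>x. ((norm (f x))\<^sup>2 + (norm (g x))\<^sup>2) / 2)"
    using f g by simp
  show "AE x in M. norm (inner (f x) (g x)) \<le> norm (((norm (f x))\<^sup>2 + (norm (g x))\<^sup>2) / 2)"
    using inner_le_mean_square by (auto simp: abs_of_nonneg)
qed measurable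

lemma integral_inner_polarization:
  fixes f g :: "'a \<Rightarrow> 'b::euclidean_space"
  assumes "f \<in> borel_measurable M" "g \<in> borel_measurable M"
    and "integrable M (\<lambda>x. (norm (f x))\<^sup>2)" and "integrable M (\<lambda>x. (norm (g x))\<^sup>2)"
  shows "(\<integral>x. inner (f x) (g x) \<partial>M) =
    ((\<integral>x. (norm (f x + g x))\<^sup>2 \<partial>M) - (\<integral>x. (norm (f x))\<^sup>2 \<partial>M) - (\<integral>x. (norm (g x))\<^sup>2 \<partial>M)) / 2"
  unfolding dot_norm using integrable_norm_square_add[OF assms] assms(3,4) by simp

text \<open>The transform is not linear over the quaternions, so polarization recovers the real
  inner product and not the quaternion-valued one.\<close>

corollary qft_parseval:
  fixes f g :: "'a::euclidean_space \<times> 'a \<Rightarrow> quat"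
  assumes f: "integrable lborel f" "integrable lborel (\<lambda>x. (norm (f x))\<^sup>2)"
    and g: "integrable lborel g" "integrable lborel (\<lambda>x. (norm (g x))\<^sup>2)"
  shows "(\<integral>w. inner (qft f w) (qft g w) \<partial>lborel) = (2 * pi) ^ DIM('a \<times> 'a) * (\<integral>y. inner (f y) (g y) \<partial>lborel)"
proof -
  have [measurable]: "f \<in> borel_measurable borel" "g \<in> borel_measurable borel"
    using f g by (auto dest: borel_measurable_integrable)
  have fg: "integrable lborel (\<lambda>y. f y + g y)" "integrable lborel (\<lambda>y. (norm (f y + g y))\<^sup>2)"
    using f g by (auto intro: integrable_norm_square_add)
  have "(\<integral>w. inner (qft f w) (qft g w) \<partial>lborel) =
     ((\<integral>w. (norm (qft (\<lambda>y. f y + g y) w))\<^sup>2 \<partial>lborel) - (\<integral>w. (norm (qft f w))\<^sup>2 \<partial>lborel)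
      - (\<integral>w. (norm (qft g w))\<^sup>2 \<partial>lborel)) / 2"
    unfolding qft_add[OF f(1) g(1)]
    by (intro integral_inner_polarization qft_contraction(1) f g) simp_all
  also have "\<dots> = (2 * pi) ^ DIM('a \<times> 'a) * (((\<integral>y. (norm (f y + g y))\<^sup>2 \<partial>lborel) - (\<integral>y. (norm (f y))\<^sup>2 \<partial>lborel)
      - (\<integral>y. (norm (g y))\<^sup>2 \<partial>lborel)) / 2)"
    unfolding qft_plancherel[OF fg] qft_plancherel[OF f] qft_plancherel[OF g]
    by (simp add: algebra_simps)
  also have "\<dots> = (2 * pi) ^ DIM('a \<times> 'a) * (\<integral>y. inner (f y) (g y) \<partial>lborel)"
    using integral_inner_polarization[of f lborel g] f g by simp
  finally show ?thesis .
qed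

section \<open>The windowed transform for Borel functions\<close>

lemma norm_mult_le_mean_square: "norm (p * q) \<le> ((norm p)\<^sup>2 + (norm (q::quat))\<^sup>2) / 2"
  using inner_le_mean_square[of "norm p" "norm q"] by (simp add: norm_mult)

definition windowed :: "('a::euclidean_space \<Rightarrow> quat) \<Rightarrow> ('a \<Rightarrow> quat) \<Rightarrow> 'a \<Rightarrow> 'a \<Rightarrow> quat" where
  "windowed g f x y = f y * qcnj (g (y - x))"

lemma integrable_windowed:
  fixes f g :: "'a::euclidean_space \<Rightarrow> quat"
  assumes [measurable]: "f \<in> borel_measurable borel" "g \<in> borel_measurable borel"
    and f: "integrable lborel (\<lambda>x. (norm (f x))\<^sup>2)" and g: "integrable lborel (\<lambda>x. (norm (g x))\<^sup>2)"
  shows "integrable lborel (windowed g f x)"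
proof (rule Bochner_Integration.integrable_bound)
  show "integrable lborel (\<lambda>y. ((norm (f y))\<^sup>2 + (norm (g (y - x)))\<^sup>2) / 2)"
    using f integrable_lborel_shift[OF g, of "- x"] by simp
  show "AE y in lborel. norm (windowed g f x y) \<le> norm (((norm (f y))\<^sup>2 + (norm (g (y - x)))\<^sup>2) / 2)"
    using norm_mult_le_mean_square[of "f y" "qcnj (g (y - x))" for y]
    by (auto simp: windowed_def intro!: AE_I2 order_trans[OF _ abs_ge_self])
  show "windowed g f x \<in> borel_measurable lborel"
    unfolding windowed_def[abs_def] by measurable
qed

text \<open>For a single \<open>x\<close> a product of two square integrable functions need not be
  square integrable. Integrated over \<open>x\<close> first, its square becomes
  \<open>(norm (f y))\<^sup>2\<close> times the energy of \<open>g\<close>, which is integrable in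
  \<open>y\<close>.\<close>

lemma integrable_windowed_square:
  fixes f g :: "'a::euclidean_space \<Rightarrow> quat"
  assumes [measurable]: "f \<in> borel_measurable borel" "g \<in> borel_measurable borel"
    and f: "integrable lborel (\<lambda>x. (norm (f x))\<^sup>2)" and g: "integrable lborel (\<lambda>x. (norm (g x))\<^sup>2)"
  shows "integrable (lborel \<Otimes>\<^sub>M lborel) (\<lambda>z. (norm (windowed g f (fst z) (snd z)))\<^sup>2)"
proof -
  define Q where "Q z = (norm (f (fst z)))\<^sup>2 * (norm (g (fst z - snd z)))\<^sup>2" for z
  have "integrable (lborel \<Otimes>\<^sub>M lborel) Q"
  proof (rule lborel_pair.Fubini_integrable)
    show "Q \<in> borel_measurable (lborel \<Otimes>\<^sub>M lborel)"
      unfolding Q_def[abs_def] by measurable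
    have "(\<integral>x. norm (Q (y, x)) \<partial>lborel) = (norm (f y))\<^sup>2 * (\<integral>x. (norm (g x))\<^sup>2 \<partial>lborel)" for y
      using integral_lborel_reflect[of "\<lambda>x. (norm (g x))\<^sup>2" y] by (simp add: Q_def)
    then show "integrable lborel (\<lambda>y. \<integral>x. norm (Q (y, x)) \<partial>lborel)"
      using f by simp
    show "AE y in lborel. integrable lborel (\<lambda>x. Q (y, x))"
      by (simp add: Q_def integrable_lborel_reflect[OF g])
  qed
  then show ?thesis
    using lborel_pair.integrable_product_swap[of Q]
    by (simp add: Q_def windowed_def case_prod_unfold norm_mult power_mult_distrib)
qed

lemma borel_measurable_windowed [measurable (raw)]:
  fixes f g :: "'a::euclidean_space \<Rightarrow> quat"
  assumes [measurable]: "f \<in> borel_measurable borel" "g \<in> borel_measurable borel"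
    "a \<in> borel_measurable M" "b \<in> borel_measurable M"
  shows "(\<lambda>z. windowed g f (a z) (b z)) \<in> borel_measurable M"
  unfolding windowed_def by measurable

text \<open>The second window moves to the first argument as a right factor, so that
  \<open>f1 y\<close> is followed by \<open>qcnj (g1 (y - x)) * g2 (y - x)\<close>. Integrating over
  \<open>x\<close> and reflecting makes this factor a constant quaternion, the source of the inner
  product of the conjugated windows.\<close>

lemma integral_inner_windowed:
  fixes f1 f2 g1 g2 :: "'a::euclidean_space \<Rightarrow> quat"
  assumes m [measurable]: "f1 \<in> borel_measurable borel" "f2 \<in> borel_measurable borel"
     "g1 \<in> borel_measurable borel" "g2 \<in> borel_measurable borel"
    and f1: "integrable lborel (\<lambda>x. (norm (f1 x))\<^sup>2)" and f2: "integrable lborel (\<lambda>x. (norm (f2 x))\<^sup>2)"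
    and g1: "integrable lborel (\<lambda>x. (norm (g1 x))\<^sup>2)" and g2: "integrable lborel (\<lambda>x. (norm (g2 x))\<^sup>2)"
  shows "integrable lborel (\<lambda>x. \<integral>y. inner (windowed g1 f1 x y) (windowed g2 f2 x y) \<partial>lborel)"
    and "(\<integral>x. (\<integral>y. inner (windowed g1 f1 x y) (windowed g2 f2 x y) \<partial>lborel) \<partial>lborel) =
      (\<integral>y. inner (f1 y * (\<integral>x. qcnj (g1 x) * g2 x \<partial>lborel)) (f2 y) \<partial>lborel)"
proof -
  let ?f = "\<lambda>x y. inner (windowed g1 f1 x y) (windowed g2 f2 x y)"
  have int: "integrable (lborel \<Otimes>\<^sub>M lborel) (\<lambda>(x, y). ?f x y)"
    unfolding case_prod_unfold
    by (intro integrable_inner_L2 integrable_windowed_square f1 f2 g1 g2 m) measurable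
  show "integrable lborel (\<lambda>x. \<integral>y. ?f x y \<partial>lborel)"
    using lborel_pair.integrable_fst'[OF int] by simp
  have gg: "integrable lborel (\<lambda>x. qcnj (g1 x) * g2 x)"
  proof (rule Bochner_Integration.integrable_bound)
    show "integrable lborel (\<lambda>x. ((norm (g1 x))\<^sup>2 + (norm (g2 x))\<^sup>2) / 2)"
      using g1 g2 by simp
    show "AE x in lborel. norm (qcnj (g1 x) * g2 x) \<le> norm (((norm (g1 x))\<^sup>2 + (norm (g2 x))\<^sup>2) / 2)"
      using norm_mult_le_mean_square[of "qcnj (g1 x)" "g2 x" for x]
      by (auto intro!: AE_I2 order_trans[OF _ abs_ge_self])
  qed measurable
  have inner: "(\<integral>x. ?f x y \<partial>lborel) = inner (f1 y * (\<integral>x. qcnj (g1 x) * g2 x \<partial>lborel)) (f2 y)" for y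
  proof -
    let ?h = "\<lambda>x. qcnj (g1 x) * g2 x"
    have "?f x y = inner (f1 y * ?h (y - x)) (f2 y)" for x
      using inner_mult_adjoint(2)[of "f2 y" "qcnj (g2 (y - x))" "f1 y * qcnj (g1 (y - x))"]
      by (simp add: windowed_def inner_commute mult.assoc)
    then have "(\<integral>x. ?f x y \<partial>lborel) = (\<integral>x. inner (f1 y * ?h (y - x)) (f2 y) \<partial>lborel)"
      by simp
    also have "\<dots> = inner (f1 y * (\<integral>x. ?h (y - x) \<partial>lborel)) (f2 y)"
      using integrable_lborel_reflect[OF gg, of y] by simp
    also have "(\<integral>x. ?h (y - x) \<partial>lborel) = (\<integral>x. ?h x \<partial>lborel)"
      by (rule integral_lborel_reflect) measurable
    finally show ?thesis .
  qed
  show "(\<integral>x. (\<integral>y. ?f x y \<partial>lborel) \<partial>lborel) =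
      (\<integral>y. inner (f1 y * (\<integral>x. qcnj (g1 x) * g2 x \<partial>lborel)) (f2 y) \<partial>lborel)"
    unfolding inner[symmetric] by (rule lborel_pair.Fubini_integral[OF int, symmetric])
qed

lemma qft_windowed_measurable:
  fixes f g :: "'a::euclidean_space \<times> 'a \<Rightarrow> quat"
  assumes [measurable]: "f \<in> borel_measurable borel" "g \<in> borel_measurable borel"
  shows "(\<lambda>z. qft (windowed g f (fst z)) (snd z)) \<in> borel_measurable borel"
proof -
  have "(\<lambda>z. \<integral>y. kern (snd z) y (windowed g f (fst z) y) \<partial>lborel)
      \<in> borel_measurable (lborel :: (('a \<times> 'a) \<times> ('a \<times> 'a)) measure)"
    by (rule lborel.borel_measurable_lebesgue_integral) (simp add: case_prod_unfold)
  then show ?thesis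
    by (simp add: qft_def[abs_def])
qed

lemma AE_windowed_square:
  fixes f g :: "'a::euclidean_space \<Rightarrow> quat"
  assumes "f \<in> borel_measurable borel" "g \<in> borel_measurable borel"
    and "integrable lborel (\<lambda>x. (norm (f x))\<^sup>2)" and "integrable lborel (\<lambda>x. (norm (g x))\<^sup>2)"
  shows "AE x in lborel. integrable lborel (\<lambda>y. (norm (windowed g f x y))\<^sup>2)"
  using lborel_pair.AE_integrable_fst'[OF integrable_windowed_square[OF assms]] by simp

lemma qft_windowed_square_integrable:
  fixes f g :: "'a::euclidean_space \<times> 'a \<Rightarrow> quat"
  assumes m [measurable]: "f \<in> borel_measurable borel" "g \<in> borel_measurable borel"
    and f: "integrable lborel (\<lambda>x. (norm (f x))\<^sup>2)" and g: "integrable lborel (\<lambda>x. (norm (g x))\<^sup>2)"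
  shows "integrable lborel (\<lambda>z. (norm (qft (windowed g f (fst z)) (snd z)))\<^sup>2)"
proof (subst lborel_prod[symmetric], rule lborel_pair.Fubini_integrable)
  note [measurable] = qft_windowed_measurable[OF m]
  note int = integrable_windowed[OF m f g]
  note AE = AE_windowed_square[OF m f g]
  show meas: "(\<lambda>z. (norm (qft (windowed g f (fst z)) (snd z)))\<^sup>2) \<in> borel_measurable (lborel \<Otimes>\<^sub>M lborel)"
    unfolding lborel_prod by measurable
  show "AE x in lborel. integrable lborel (\<lambda>w. (norm (qft (windowed g f (fst (x, w))) (snd (x, w))))\<^sup>2)"
    using AE by eventually_elim (simp add: qft_contraction(1) int)
  have "integrable lborel (\<lambda>x. (2 * pi) ^ DIM('a \<times> 'a) * (\<integral>y. (norm (windowed g f x y))\<^sup>2 \<partial>lborel))"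
    \<comment> \<open>The diagonal case of the inner product formula.\<close>
    using integral_inner_windowed(1)[OF m(1) m(1) m(2) m(2) f f g g] by (simp add: power2_norm_eq_inner)
  then show "integrable lborel (\<lambda>x. \<integral>w. norm ((norm (qft (windowed g f (fst (x, w))) (snd (x, w))))\<^sup>2) \<partial>lborel)"
  \<comment> \<open>Plancherel's identity is available only for those \<open>x\<close> whose
    windowed product is square integrable, so the two functions of \<open>x\<close> agree just
    almost everywhere and measurability is shown separately.\<close>
  proof (rule integrable_cong_AE_imp)
    show "(\<lambda>x. \<integral>w. norm ((norm (qft (windowed g f (fst (x, w))) (snd (x, w))))\<^sup>2) \<partial>lborel) \<in> borel_measurable lborel"
      using meas by (intro lborel.borel_measurable_lebesgue_integral) (simp add: case_prod_unfold)
    show "AE x in lborel. (2 * pi) ^ DIM('a \<times> 'a) * (\<integral>y. (norm (windowed g f x y))\<^sup>2 \<partial>lborel) =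
        (\<integral>w. norm ((norm (qft (windowed g f (fst (x, w))) (snd (x, w))))\<^sup>2) \<partial>lborel)"
      using AE by eventually_elim (simp add: qft_plancherel int)
  qed
qed

lemma integral_inner_qft_windowed:
  fixes f1 f2 g1 g2 :: "'a::euclidean_space \<times> 'a \<Rightarrow> quat"
  assumes m [measurable]: "f1 \<in> borel_measurable borel" "f2 \<in> borel_measurable borel"
     "g1 \<in> borel_measurable borel" "g2 \<in> borel_measurable borel"
    and f1: "integrable lborel (\<lambda>x. (norm (f1 x))\<^sup>2)" and f2: "integrable lborel (\<lambda>x. (norm (f2 x))\<^sup>2)"
    and g1: "integrable lborel (\<lambda>x. (norm (g1 x))\<^sup>2)" and g2: "integrable lborel (\<lambda>x. (norm (g2 x))\<^sup>2)"
  shows "(\<integral>z. inner (qft (windowed g1 f1 (fst z)) (snd z)) (qft (windowed g2 f2 (fst z)) (snd z)) \<partial>lborel) =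
    (2 * pi) ^ DIM('a \<times> 'a) * (\<integral>y. inner (f1 y * (\<integral>x. qcnj (g1 x) * g2 x \<partial>lborel)) (f2 y) \<partial>lborel)"
proof -
  let ?F = "\<lambda>z. inner (qft (windowed g1 f1 (fst z)) (snd z)) (qft (windowed g2 f2 (fst z)) (snd z))"
  note qm [measurable] = qft_windowed_measurable[OF m(1,3)] qft_windowed_measurable[OF m(2,4)]
  have int: "integrable (lborel \<Otimes>\<^sub>M lborel) ?F"
    unfolding lborel_prod
    by (intro integrable_inner_L2 qft_windowed_square_integrable m f1 f2 g1 g2) simp_all
  have "integral\<^sup>L lborel ?F = (\<integral>x. (\<integral>w. ?F (x, w) \<partial>lborel) \<partial>lborel)"
    using lborel_pair.integral_fst'[OF int] by (simp add: lborel_prod)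
  also have "\<dots> = (\<integral>x. (2 * pi) ^ DIM('a \<times> 'a) *
      (\<integral>y. inner (windowed g1 f1 x y) (windowed g2 f2 x y) \<partial>lborel) \<partial>lborel)"
  proof (rule integral_cong_AE)
    show "(\<lambda>x. \<integral>w. ?F (x, w) \<partial>lborel) \<in> borel_measurable lborel"
      using lborel_pair.integrable_fst'[OF int] by (rule borel_measurable_integrable)
    show "(\<lambda>x. (2 * pi) ^ DIM('a \<times> 'a) * (\<integral>y. inner (windowed g1 f1 x y) (windowed g2 f2 x y) \<partial>lborel))
        \<in> borel_measurable lborel"
      by (intro borel_measurable_times borel_measurable_const
          borel_measurable_integrable[OF integral_inner_windowed(1)[OF m f1 f2 g1 g2]])
    show "AE x in lborel. (\<integral>w. ?F (x, w) \<partial>lborel) =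
        (2 * pi) ^ DIM('a \<times> 'a) * (\<integral>y. inner (windowed g1 f1 x y) (windowed g2 f2 x y) \<partial>lborel)"
      using AE_windowed_square[OF m(1,3) f1 g1] AE_windowed_square[OF m(2,4) f2 g2]
      by eventually_elim (simp add: qft_parseval integrable_windowed f1 f2 g1 g2)
  qed
  also have "\<dots> = (2 * pi) ^ DIM('a \<times> 'a) * (\<integral>y. inner (f1 y * (\<integral>x. qcnj (g1 x) * g2 x \<partial>lborel)) (f2 y) \<partial>lborel)"
    using integral_inner_windowed(2)[OF m f1 f2 g1 g2] by simp
  finally show ?thesis .
qed

section \<open>Transfer to Lebesgue measurable functions\<close>

definition mu_const :: "'a::euclidean_space itself \<Rightarrow> real" where
  "mu_const _ = 1 / (2 * pi) powr (real DIM('a) / 2)"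

lemma mu_const_pos [simp]: "mu_const TYPE('a::euclidean_space) > 0"
  by (simp add: mu_const_def)

lemma mu_eq: "(mu :: 'a::euclidean_space measure) = density lebesgue (\<lambda>_. ennreal (mu_const TYPE('a)))"
  by (simp add: mu_def mu_const_def)

text \<open>The density of \<open>mu\<close> on the doubled space is the reciprocal of the
  Plancherel constant of a single copy.\<close>

lemma mu_const_prod: "mu_const TYPE('a::euclidean_space \<times> 'a) * (2 * pi) ^ DIM('a) = 1"
  by (simp add: mu_const_def powr_realpow field_simps flip: mult_2)

lemma sets_mu [simp, measurable_cong]: "sets (mu :: 'a::euclidean_space measure) = sets lebesgue"
  and space_mu [simp]: "space (mu :: 'a measure) = UNIV"
  by (simp_all add: mu_def)

lemma borel_measurable_mu: "borel_measurable (mu :: 'a::euclidean_space measure) = borel_measurable lebesgue"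
  by (rule measurable_cong_sets) simp_all

lemma borel_measurable_mu_borel:
  "f \<in> borel_measurable borel \<Longrightarrow> f \<in> borel_measurable (mu :: 'a::euclidean_space measure)"
  unfolding borel_measurable_mu by (rule measurable_completion) simp

lemma AE_mu_iff: "(AE x in (mu :: 'a::euclidean_space measure). P x) \<longleftrightarrow> (AE x in lborel. P x)"
  unfolding mu_eq by (subst AE_density) (simp_all add: AE_completion_iff)

lemma integrable_mu_iff:
  fixes f :: "'a::euclidean_space \<Rightarrow> 'b::{banach, second_countable_topology}"
  assumes f: "f \<in> borel_measurable borel"
  shows "integrable mu f \<longleftrightarrow> integrable lborel f"
proof -
  have "f \<in> borel_measurable lebesgue"
    using f by (intro measurable_completion) simp
  then have "integrable mu f \<longleftrightarrow> integrable lebesgue (\<lambda>x. mu_const TYPE('a) *\<^sub>R f x)"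
    unfolding mu_eq by (intro integrable_density) (simp_all add: less_imp_le)
  also have "\<dots> \<longleftrightarrow> integrable lborel (\<lambda>x. mu_const TYPE('a) *\<^sub>R f x)"
    using f by (intro integrable_completion) simp
  also have "\<dots> \<longleftrightarrow> integrable lborel f"
    using integrable_scaleR_right[of "mu_const TYPE('a)" lborel f] mu_const_pos[where 'a='a]
      integrable_scaleR_right[of "1 / mu_const TYPE('a)" lborel "\<lambda>x. mu_const TYPE('a) *\<^sub>R f x"]
    by (auto simp: less_imp_neq[symmetric])
  finally show ?thesis .
qed

lemma integral_mu:
  fixes f :: "'a::euclidean_space \<Rightarrow> 'b::{banach, second_countable_topology}"
  assumes f: "f \<in> borel_measurable borel"
  shows "integral\<^sup>L mu f = mu_const TYPE('a) *\<^sub>R integral\<^sup>L lborel f"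
proof -
  have "f \<in> borel_measurable lebesgue"
    using f by (intro measurable_completion) simp
  then have "integral\<^sup>L mu f = integral\<^sup>L lebesgue (\<lambda>x. mu_const TYPE('a) *\<^sub>R f x)"
    unfolding mu_eq by (intro integral_density) (simp_all add: less_imp_le)
  also have "\<dots> = integral\<^sup>L lborel (\<lambda>x. mu_const TYPE('a) *\<^sub>R f x)"
    using f by (intro integral_completion) simp
  finally show ?thesis by simp
qed

section \<open>Square integrable classes and their Borel representatives\<close>

lemma L2_cong_AE:
  assumes f: "f \<in> L2" and AE: "AE x in mu. f x = g x"
  shows "g \<in> L2"
proof -
  have fm: "f \<in> borel_measurable lebesgue" and fi: "integrable mu (\<lambda>x. (norm (f x))\<^sup>2)"
    using f by (simp_all add: L2_def borel_measurable_mu)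
  have gm: "g \<in> borel_measurable mu"
    unfolding borel_measurable_mu
    by (rule borel_measurable_AE[OF fm]) (use AE in \<open>simp add: AE_mu_iff AE_completion_iff\<close>)
  moreover have "integrable mu (\<lambda>x. (norm (g x))\<^sup>2)"
    by (rule integrable_cong_AE_imp[OF fi]) (use gm AE in \<open>auto elim: eventually_mono\<close>)
  ultimately show ?thesis
    by (simp add: L2_def)
qed

lemma L2_borel_iff:
  assumes f: "f \<in> borel_measurable borel"
  shows "f \<in> L2 \<longleftrightarrow> integrable lborel (\<lambda>x. (norm (f x))\<^sup>2)"
  using f by (simp add: L2_def borel_measurable_mu_borel integrable_mu_iff)

lemma L2_borel_representative:
  fixes f :: "'a::euclidean_space \<Rightarrow> quat"
  assumes f: "f \<in> L2"
  obtains f' where "f' \<in> borel_measurable borel" "f' \<in> L2" "AE x in mu. f x = f' x"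
proof -
  have "f measurable_on UNIV"
    using f by (intro lebesgue_measurable_imp_measurable_on) (simp_all add: L2_def borel_measurable_mu)
  then obtain N g where N: "negligible N" and cont: "\<And>n. continuous_on UNIV (g n)"
    and lim: "\<And>x. x \<notin> N \<Longrightarrow> (\<lambda>n. g n x) \<longlonglongrightarrow> f x"
    unfolding measurable_on_def by auto
  \<comment> \<open>Where the sequence diverges, \<open>lim\<close> takes one fixed value;
    \<open>f'\<close> is thus Borel on the whole space and not merely off the null set
    \<open>N\<close>.\<close>
  define f' where "f' x = lim (\<lambda>n. g n x)" for x
  have "g n \<in> borel_measurable borel" for n
    using cont by (rule borel_measurable_continuous_onI)
  then have "f' \<in> borel_measurable borel"
    unfolding f'_def by (rule borel_measurable_lim_metric)
  moreover have "AE x in mu. x \<notin> N"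
    using N AE_not_in[of N lebesgue] by (simp add: negligible_iff_null_sets AE_completion_iff AE_mu_iff)
  then have AE: "AE x in mu. f x = f' x"
    by eventually_elim (simp add: f'_def limI[OF lim])
  ultimately show thesis
    using that L2_cong_AE[OF f] by blast
qed

lemma L2_measurable: "f \<in> L2 \<Longrightarrow> f \<in> borel_measurable mu"
  and L2_integrable: "f \<in> L2 \<Longrightarrow> integrable mu (\<lambda>x. (norm (f x))\<^sup>2)"
  by (simp_all add: L2_def)

lemma inner_L2_eq:
  assumes f: "f \<in> L2" and g: "g \<in> L2"
  shows "inner_L2 f g = (\<integral>x. inner (f x) (g x) \<partial>mu)"
proof -
  note [measurable] = L2_measurable[OF f] L2_measurable[OF g]
  have "integrable mu (\<lambda>x. f x * qcnj (g x))"
  proof (rule Bochner_Integration.integrable_bound)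
    show "integrable mu (\<lambda>x. ((norm (f x))\<^sup>2 + (norm (g x))\<^sup>2) / 2)"
      using L2_integrable[OF f] L2_integrable[OF g] by simp
    show "AE x in mu. norm (f x * qcnj (g x)) \<le> norm (((norm (f x))\<^sup>2 + (norm (g x))\<^sup>2) / 2)"
      using norm_mult_le_mean_square[of "f x" "qcnj (g x)" for x]
      by (auto intro!: AE_I2 order_trans[OF _ abs_ge_self])
  qed measurable
  then show ?thesis
    unfolding inner_L2_def qinner_L2_def inner_quat_eq_Sc
    by (rule integral_bounded_linear[OF bounded_linear_Sc, symmetric])
qed

lemma norm_L2_eq: "f \<in> L2 \<Longrightarrow> norm_L2 f = sqrt (inner_L2 f f)"
  by (simp add: inner_L2_eq norm_L2_def power2_norm_eq_inner)

lemma qinner_L2_cong_AE: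
  assumes "f \<in> borel_measurable mu" "f' \<in> borel_measurable mu" "g \<in> borel_measurable mu" "g' \<in> borel_measurable mu"
    and AE: "AE x in mu. f x = f' x" "AE x in mu. g x = g' x"
  shows "qinner_L2 f g = qinner_L2 f' g'"
  unfolding qinner_L2_def
proof (rule integral_cong_AE)
  show "AE x in mu. f x * qcnj (g x) = f' x * qcnj (g' x)"
    using AE by eventually_elim simp
qed (use assms in measurable)

lemma inner_L2_cong_AE:
  assumes "f \<in> L2" "f' \<in> L2" "g \<in> L2" "g' \<in> L2"
    and "AE x in mu. f x = f' x" "AE x in mu. g x = g' x"
  shows "inner_L2 f g = inner_L2 f' g'"
  unfolding inner_L2_def using assms by (simp add: qinner_L2_cong_AE[of f f' g g'] L2_measurable)

lemma L2_mult_right: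
  assumes f: "f \<in> L2"
  shows "(\<lambda>x. f x * q) \<in> L2"
proof -
  note [measurable] = L2_measurable[OF f]
  show ?thesis
    using L2_integrable[OF f] by (simp add: L2_def norm_mult power_mult_distrib)
qed

lemma L2_scaleR:
  assumes f: "f \<in> L2"
  shows "(\<lambda>x. r *\<^sub>R f x) \<in> L2"
proof -
  note [measurable] = L2_measurable[OF f]
  show ?thesis
    using L2_integrable[OF f] by (simp add: L2_def power_mult_distrib)
qed

lemma AE_mu_shift:
  assumes "AE x in (mu :: 'a::euclidean_space measure). P x"
  shows "AE x in mu. P (x - t)"
proof -
  have "AE x in distr lborel borel ((+) (- t)). P x"
    using assms unfolding lborel_distr_plus AE_mu_iff .
  then have "AE x in lborel. P (- t + x)"
    by (rule AE_distrD[rotated]) simp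
  then show ?thesis
    by (simp add: AE_mu_iff)
qed

text \<open>For each fixed \<open>x\<close> and \<open>w\<close>, changing \<open>f\<close> or
  \<open>g\<close> on a null set changes the integrand only on a null set. So passing to
  representatives alters the transform at no point at all.\<close>

lemma qwft_eq_qft:
  fixes f g f' g' :: "(real^'d) \<times> (real^'d) \<Rightarrow> quat"
  assumes m [measurable]: "f' \<in> borel_measurable borel" "g' \<in> borel_measurable borel"
    and f: "AE y in mu. f y = f' y" and g: "AE y in mu. g y = g' y"
  shows "qwft g f = (\<lambda>z. mu_const TYPE((real^'d) \<times> (real^'d)) *\<^sub>R qft (windowed g' f' (fst z)) (snd z))"
proof
  fix z :: "((real^'d) \<times> (real^'d)) \<times> ((real^'d) \<times> (real^'d))"
  let ?k = "\<lambda>g f y. kern (snd z) y (windowed g f (fst z) y)"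
  have [measurable]: "?k g' f' \<in> borel_measurable borel"
    by measurable
  have AE: "AE y in mu. ?k g' f' y = ?k g f y"
    using f AE_mu_shift[OF g, of "fst z"] by eventually_elim (simp add: windowed_def)
  have k': "?k g' f' \<in> borel_measurable mu"
    by (rule borel_measurable_mu_borel) measurable
  \<comment> \<open>Completeness of Lebesgue measure: the integrand agrees almost everywhere with a
    measurable one.\<close>
  have k: "?k g f \<in> borel_measurable mu"
    unfolding borel_measurable_mu
    by (rule borel_measurable_AE[of "?k g' f'"])
      (use k' AE in \<open>simp_all add: borel_measurable_mu AE_mu_iff AE_completion_iff\<close>)
  have "qwft g f z = (\<integral>y. ?k g f y \<partial>mu)"
    by (cases z) (simp add: qwft_def kern_def windowed_def case_prod_unfold mult.assoc)
  also have "\<dots> = (\<integral>y. ?k g' f' y \<partial>mu)"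
    using AE by (intro integral_cong_AE k k') (auto elim: eventually_mono)
  also have "\<dots> = mu_const TYPE((real^'d) \<times> (real^'d)) *\<^sub>R qft (windowed g' f' (fst z)) (snd z)"
    unfolding qft_def by (rule integral_mu) measurable
  finally show "qwft g f z = mu_const TYPE((real^'d) \<times> (real^'d)) *\<^sub>R qft (windowed g' f' (fst z)) (snd z)" .
qed

lemma qwft_in_L2:
  fixes f g :: "(real^'d) \<times> (real^'d) \<Rightarrow> quat"
  assumes f: "f \<in> L2" and g: "g \<in> L2"
  shows "qwft g f \<in> L2"
proof -
  obtain f' where f': "f' \<in> borel_measurable borel" "f' \<in> L2" "AE x in mu. f x = f' x"
    using L2_borel_representative[OF f] .
  obtain g' where g': "g' \<in> borel_measurable borel" "g' \<in> L2" "AE x in mu. g x = g' x"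
    using L2_borel_representative[OF g] .
  have "(\<lambda>z. qft (windowed g' f' (fst z)) (snd z)) \<in> L2"
    using qft_windowed_measurable[OF f'(1) g'(1)] qft_windowed_square_integrable[OF f'(1) g'(1)] f' g'
    by (simp add: L2_borel_iff)
  then show ?thesis
    unfolding qwft_eq_qft[OF f'(1) g'(1) f'(3) g'(3)] by (rule L2_scaleR)
qed

lemma inner_L2_qwft:
  fixes f1 f2 g1 g2 :: "(real^'d) \<times> (real^'d) \<Rightarrow> quat"
  assumes f1: "f1 \<in> L2" and f2: "f2 \<in> L2" and g1: "g1 \<in> L2" and g2: "g2 \<in> L2"
  shows "inner_L2 (qwft g1 f1) (qwft g2 f2) =
    inner_L2 (\<lambda>y. f1 y * qinner_L2 (\<lambda>x. qcnj (g1 x)) (\<lambda>x. qcnj (g2 x))) f2"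
proof -
  let ?V = "TYPE((real^'d) \<times> (real^'d))"
  obtain f1' where f1': "f1' \<in> borel_measurable borel" "f1' \<in> L2" "AE x in mu. f1 x = f1' x"
    using L2_borel_representative[OF f1] .
  obtain f2' where f2': "f2' \<in> borel_measurable borel" "f2' \<in> L2" "AE x in mu. f2 x = f2' x"
    using L2_borel_representative[OF f2] .
  obtain g1' where g1': "g1' \<in> borel_measurable borel" "g1' \<in> L2" "AE x in mu. g1 x = g1' x"
    using L2_borel_representative[OF g1] .
  obtain g2' where g2': "g2' \<in> borel_measurable borel" "g2' \<in> L2" "AE x in mu. g2 x = g2' x"
    using L2_borel_representative[OF g2] .
  note m [measurable] = f1'(1) f2'(1) g1'(1) g2'(1)
  have qm: "(\<lambda>z. qft (windowed g1' f1' (fst z)) (snd z)) \<in> borel_measurable borel"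
    "(\<lambda>z. qft (windowed g2' f2' (fst z)) (snd z)) \<in> borel_measurable borel"
    by (simp_all add: qft_windowed_measurable m)
  note [measurable] = L2_measurable[OF g1] L2_measurable[OF g2] L2_measurable[OF g1'(2)] L2_measurable[OF g2'(2)]
  define Q where "Q = (\<integral>x. qcnj (g1' x) * g2' x \<partial>lborel)"
  have Q: "qinner_L2 (\<lambda>x. qcnj (g1 x)) (\<lambda>x. qcnj (g2 x)) = mu_const ?V *\<^sub>R Q"
  proof -
    have "qinner_L2 (\<lambda>x. qcnj (g1 x)) (\<lambda>x. qcnj (g2 x)) = qinner_L2 (\<lambda>x. qcnj (g1' x)) (\<lambda>x. qcnj (g2' x))"
      by (rule qinner_L2_cong_AE) (use g1'(3) g2'(3) in \<open>auto elim: eventually_mono\<close>)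
    also have "\<dots> = mu_const ?V *\<^sub>R Q"
      unfolding qinner_L2_def Q_def qcnj_qcnj by (rule integral_mu) measurable
    finally show ?thesis .
  qed
  have "inner_L2 (qwft g1 f1) (qwft g2 f2) = (\<integral>z. inner (qwft g1 f1 z) (qwft g2 f2 z) \<partial>mu)"
    by (intro inner_L2_eq qwft_in_L2 f1 f2 g1 g2)
  also have "\<dots> = mu_const ?V * mu_const ?V *
      (\<integral>z. inner (qft (windowed g1' f1' (fst z)) (snd z)) (qft (windowed g2' f2' (fst z)) (snd z)) \<partial>mu)"
    unfolding qwft_eq_qft[OF m(1,3) f1'(3) g1'(3)] qwft_eq_qft[OF m(2,4) f2'(3) g2'(3)]
    by (simp add: mult.assoc)
  also have "\<dots> = mu_const ?V * mu_const ?V * (mu_const TYPE(((real^'d) \<times> (real^'d)) \<times> ((real^'d) \<times> (real^'d))) *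
      (\<integral>z. inner (qft (windowed g1' f1' (fst z)) (snd z)) (qft (windowed g2' f2' (fst z)) (snd z)) \<partial>lborel))"
    using qm by (subst integral_mu) simp_all
  also have "\<dots> = mu_const ?V * mu_const ?V * ((mu_const TYPE(((real^'d) \<times> (real^'d)) \<times> ((real^'d) \<times> (real^'d))) *
      (2 * pi) ^ DIM((real^'d) \<times> (real^'d))) * (\<integral>y. inner (f1' y * Q) (f2' y) \<partial>lborel))"
    using f1'(2) f2'(2) g1'(2) g2'(2) unfolding Q_def
    by (subst integral_inner_qft_windowed[OF m]) (simp_all only: L2_borel_iff m mult.assoc)
  also have "\<dots> = mu_const ?V * mu_const ?V * (\<integral>y. inner (f1' y * Q) (f2' y) \<partial>lborel)"
    unfolding mu_const_prod by simp
  \<comment> \<open>Of the two remaining factors one turns \<open>Q\<close> into the inner product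
    of the windows, the other turns the integral over \<open>y\<close> into one with respect to
    \<open>mu\<close>.\<close>
  also have "\<dots> = (\<integral>y. inner (f1' y * (mu_const ?V *\<^sub>R Q)) (f2' y) \<partial>mu)"
    by (subst integral_mu) simp_all
  also have "\<dots> = inner_L2 (\<lambda>y. f1' y * (mu_const ?V *\<^sub>R Q)) f2'"
    by (intro inner_L2_eq[symmetric] L2_mult_right f1' f2')
  also have "\<dots> = inner_L2 (\<lambda>y. f1 y * (mu_const ?V *\<^sub>R Q)) f2"
    using f1'(3) f2'(3) by (intro inner_L2_cong_AE L2_mult_right f1 f2 f1'(2) f2'(2)) (auto elim: eventually_mono)
  finally show ?thesis
    unfolding Q .
qed

text \<open>With equal windows the quaternion-valued inner product of the conjugated window with
  itself is real, so it leaves the remaining inner product as a scalar.\<close>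

lemma norm_L2_qwft:
  fixes f g :: "(real^'d) \<times> (real^'d) \<Rightarrow> quat"
  assumes f: "f \<in> L2" and g: "g \<in> L2"
  shows "norm_L2 (qwft g f) = norm_L2 f * norm_L2 g"
proof -
  let ?G = "\<integral>x. (norm (g x))\<^sup>2 \<partial>mu"
  have "qcnj (g x) * qcnj (qcnj (g x)) = of_real ((norm (g x))\<^sup>2)" for x
    using quat_mult_qcnj[of "qcnj (g x)"] by simp
  then have "qinner_L2 (\<lambda>x. qcnj (g x)) (\<lambda>x. qcnj (g x)) = (\<integral>x. of_real ((norm (g x))\<^sup>2) \<partial>mu)"
    unfolding qinner_L2_def by (simp only:)
  also have "\<dots> = of_real ?G"
    by (rule integral_of_real[OF L2_integrable[OF g]])
  finally have "inner_L2 (qwft g f) (qwft g f) = inner_L2 (\<lambda>y. f y * of_real ?G) f"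
    by (simp only: inner_L2_qwft[OF f f g g])
  also have "\<dots> = (\<integral>y. inner (f y * of_real ?G) (f y) \<partial>mu)"
    by (intro inner_L2_eq L2_mult_right f)
  also have "\<dots> = (\<integral>y. ?G * (norm (f y))\<^sup>2 \<partial>mu)"
    by (simp only: of_real_def mult_scaleR_right mult_1_right inner_scaleR_left power2_norm_eq_inner)
  also have "\<dots> = (\<integral>y. (norm (f y))\<^sup>2 \<partial>mu) * ?G"
    by simp
  finally show ?thesis
    unfolding norm_L2_eq[OF qwft_in_L2[OF f g]] by (simp only: norm_L2_def real_sqrt_mult)
qed

text \<open>Additivity holds at every point, because the windowed products of the representatives
  are integrable for every \<open>x\<close> and not just for almost every one.\<close>

lemma qwft_add:
  fixes f h g :: "(real^'d) \<times> (real^'d) \<Rightarrow> quat"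
  assumes f: "f \<in> L2" and h: "h \<in> L2" and g: "g \<in> L2"
  shows "qwft g (\<lambda>y. f y + h y) z = qwft g f z + qwft g h z"
proof -
  obtain f' where f': "f' \<in> borel_measurable borel" "f' \<in> L2" "AE x in mu. f x = f' x"
    using L2_borel_representative[OF f] .
  obtain h' where h': "h' \<in> borel_measurable borel" "h' \<in> L2" "AE x in mu. h x = h' x"
    using L2_borel_representative[OF h] .
  obtain g' where g': "g' \<in> borel_measurable borel" "g' \<in> L2" "AE x in mu. g x = g' x"
    using L2_borel_representative[OF g] .
  note [measurable] = f'(1) h'(1)
  have sum: "(\<lambda>y. f' y + h' y) \<in> borel_measurable borel" "AE y in mu. f y + h y = f' y + h' y"
    using f'(3) h'(3) by (measurable, auto elim: eventually_elim2)
  have "windowed g' (\<lambda>y. f' y + h' y) x = (\<lambda>y. windowed g' f' x y + windowed g' h' x y)" for x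
    by (simp add: windowed_def fun_eq_iff algebra_simps)
  moreover have "integrable lborel (windowed g' f' x)" "integrable lborel (windowed g' h' x)" for x
    using f' g' h' by (simp_all add: integrable_windowed L2_borel_iff)
  ultimately show ?thesis
    unfolding qwft_eq_qft[OF sum(1) g'(1) sum(2) g'(3)] qwft_eq_qft[OF f'(1) g'(1) f'(3) g'(3)]
      qwft_eq_qft[OF h'(1) g'(1) h'(3) g'(3)]
    by (simp add: qft_add scaleR_add_right)
qed

text \<open>Where the integrand is not integrable, both integrals have the default value 0;
  elsewhere the scalar is pulled out.\<close>

lemma qwft_scaleR: "qwft g (\<lambda>y. r *\<^sub>R f y) z = r *\<^sub>R qwft g f z"
  by (cases z) (simp add: qwft_def case_prod_unfold)

lemma bounded_linear_L2_qwft: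
  fixes g :: "(real^'d) \<times> (real^'d) \<Rightarrow> quat"
  assumes g: "g \<in> L2"
  shows "bounded_linear_L2 (qwft g)"
  unfolding bounded_linear_L2_def
proof (intro conjI ballI impI allI)
  fix f h :: "(real^'d) \<times> (real^'d) \<Rightarrow> quat"
  assume f: "f \<in> L2" and h: "h \<in> L2"
  show "AE z in mu. qwft g (\<lambda>y. f y + h y) z = qwft g f z + qwft g h z"
    by (simp add: qwft_add f h g)
  assume AE: "AE y in mu. f y = h y"
  obtain h' where h': "h' \<in> borel_measurable borel" "AE x in mu. h x = h' x"
    using L2_borel_representative[OF h] .
  obtain g' where g': "g' \<in> borel_measurable borel" "AE x in mu. g x = g' x"
    using L2_borel_representative[OF g] .
  \<comment> \<open>A single Borel representative serves \<open>f\<close> and \<open>h\<close>, so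
    their transforms are the same function.\<close>
  have "AE x in mu. f x = h' x"
    using AE h'(2) by eventually_elim simp
  then have "qwft g f = qwft g h"
    by (simp only: qwft_eq_qft[OF h'(1) g'(1) _ g'(2)] h'(2))
  then show "AE z in mu. qwft g f z = qwft g h z"
    by simp
next
  show "\<exists>K. \<forall>f\<in>L2. norm_L2 (qwft g f) \<le> norm_L2 f * K"
    using norm_L2_qwft[OF _ g] by (intro exI[of _ "norm_L2 g"]) simp
qed (simp_all add: qwft_in_L2 g qwft_scaleR)

theorem theorem4:
  fixes g1 g2 :: "(real^'d) \<times> (real^'d) \<Rightarrow> quat"
  assumes "quat_window g1" and "quat_window g2"
  shows "(\<forall>f1\<in>L2. \<forall>f2\<in>L2.
            inner_L2 (qwft g1 f1) (qwft g2 f2) =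
            inner_L2 (\<lambda>y. f1 y * qinner_L2 (\<lambda>x. qcnj (g1 x)) (\<lambda>x. qcnj (g2 x))) f2)
       \<and> (\<forall>f\<in>L2. norm_L2 (qwft g1 f) = norm_L2 f * norm_L2 g1)
       \<and> (\<forall>g :: (real^'d) \<times> (real^'d) \<Rightarrow> quat. quat_window g \<longrightarrow>
            bounded_linear_L2 (qwft g) \<and> (norm_L2 g = 1 \<longrightarrow> isometric_L2 (qwft g)))"
proof -
  have "g1 \<in> L2" "g2 \<in> L2"
    using assms by (simp_all add: quat_window_def)
  then show ?thesis
    by (auto simp: quat_window_def isometric_L2_def inner_L2_qwft norm_L2_qwft bounded_linear_L2_qwft)
qed

end
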